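(* Let $n>2$ and let $\mathcal{D}$ be a set of $n$ topological disks in the plane in general position with overlap number $\Delta$. Then the diameter of the dual graph of the arrangement $\mathcal{A}(\mathcal{D})$ is at most $2n\cdot\min\{n,\Delta+1\}\cdot(\Delta+1)^{n(n-1)/2}$.
   Context: A topological disk is a closed region of the plane bounded by a closed Jordan curve. A set $\mathcal{D}$ of topological disks is in general position if for any two disks $D_i,D_j$ the set $\partial D_i\cap\partial D_j$ is finite, the boundaries properly cross at each intersection point (no tangencies), and no three disk boundaries share a point. The arrangement $\mathcal{A}(\mathcal{D})$ is the subdivision of the plane into faces, edges and vertices induced by the disk boundaries. Its dual graph has one node per face, two nodes being adjacent iff the corresponding faces share at least one edge. The diameter of a graph is the maximum hop-distance between two of its nodes. For $D_i,D_j\in\mathcal{D}$, $\Delta_{ij}$ is the number of connected components of $D_i\cap D_j$, and the overlap number of $\mathcal{D}$ is $\Delta=\max_{i,j}\Delta_{ij}$. *)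

theory Defs
  imports
    "HOL-Analysis.Analysis"
    "Graph_Theory.Pair_Digraph"
    "Graph_Theory.Shortest_Path"
begin

section \<open>Topological disks\<close>

definition topological_disk :: "complex set \<Rightarrow> bool" where
  "topological_disk D \<longleftrightarrow>
     (\<exists>c. simple_path c \<and> pathfinish c = pathstart c \<and> D = path_image c \<union> inside (path_image c))"

text \<open>
  The boundary of a disk is written \<^term>\<open>frontier D\<close>; the following lemma shows that this is
  the Jordan curve that bounds it.
\<close>

lemma frontier_Jordan_region:
  fixes c :: "real \<Rightarrow> complex"
  assumes "simple_path c" "pathfinish c = pathstart c"
  shows "frontier (path_image c \<union> inside (path_image c)) = path_image c"
proof -
  have "path_image c \<union> inside (path_image c) = - outside (path_image c)"
    by (rule union_with_inside)
  moreover have "frontier (outside (path_image c)) = path_image c"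
    using Jordan_inside_outside[OF assms] by blast
  ultimately show ?thesis
    by (simp add: frontier_complement)
qed

section \<open>General position\<close>

text \<open>
  Two curves cross properly at \<open>p\<close> if some homeomorphism of a neighbourhood of \<open>p\<close> onto the
  unit disk takes them to the two coordinate axes. In particular each curve passes from one
  side of the other to the opposite side, which excludes tangencies.
\<close>

definition properly_cross_at :: "complex set \<Rightarrow> complex set \<Rightarrow> complex \<Rightarrow> bool" where
  "properly_cross_at S T p \<longleftrightarrow>
     (\<exists>U h g. open U \<and> p \<in> U \<and> homeomorphism U (ball 0 1) h g \<and> h p = 0 \<and>
        h ` (U \<inter> S) = {z \<in> ball 0 1. Im z = 0} \<and>
        h ` (U \<inter> T) = {z \<in> ball 0 1. Re z = 0})"

definition general_position :: "complex set set \<Rightarrow> bool" where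
  "general_position \<D> \<longleftrightarrow>
     (\<forall>A\<in>\<D>. \<forall>B\<in>\<D>. A \<noteq> B \<longrightarrow>
        finite (frontier A \<inter> frontier B) \<and>
        (\<forall>p \<in> frontier A \<inter> frontier B. properly_cross_at (frontier A) (frontier B) p)) \<and>
     (\<forall>A\<in>\<D>. \<forall>B\<in>\<D>. \<forall>C\<in>\<D>. A \<noteq> B \<and> B \<noteq> C \<and> A \<noteq> C \<longrightarrow>
        frontier A \<inter> frontier B \<inter> frontier C = {})"

section \<open>Overlap number\<close>

text \<open>
  For disks in general position the intersections have only finitely many components, so
  \<^const>\<open>card\<close> is the actual number. The maximum is over pairs of distinct disks, so a
  family of pairwise disjoint disks has overlap number 0.
\<close>

definition overlap_number :: "complex set set \<Rightarrow> nat" where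
  "overlap_number \<D> = Max {card (components (A \<inter> B)) | A B. A \<in> \<D> \<and> B \<in> \<D> \<and> A \<noteq> B}"

section \<open>The arrangement and its dual graph\<close>

definition arr_vertices :: "complex set set \<Rightarrow> complex set" where
  "arr_vertices \<D> = (\<Union>A\<in>\<D>. \<Union>B\<in>\<D> - {A}. frontier A \<inter> frontier B)"

text \<open>
  A boundary that meets no other boundary is a single edge (a closed curve without vertices).
\<close>

definition arr_edges :: "complex set set \<Rightarrow> complex set set" where
  "arr_edges \<D> = components ((\<Union>D\<in>\<D>. frontier D) - arr_vertices \<D>)"

definition arr_faces :: "complex set set \<Rightarrow> complex set set" where
  "arr_faces \<D> = components (- (\<Union>D\<in>\<D>. frontier D))"

text \<open>An undirected graph is represented by its symmetric set of arcs.\<close>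

definition dual_graph :: "complex set set \<Rightarrow> complex set pair_pre_digraph" where
  "dual_graph \<D> = \<lparr> pverts = arr_faces \<D>,
     parcs = {(F, G). F \<in> arr_faces \<D> \<and> G \<in> arr_faces \<D> \<and> F \<noteq> G \<and>
                      (\<exists>e\<in>arr_edges \<D>. e \<subseteq> frontier F \<and> e \<subseteq> frontier G)} \<rparr>"

lemma wf_dual_graph: "wf_digraph (with_proj (dual_graph \<D>))"
  by unfold_locales (auto simp: dual_graph_def)

text \<open>
  With unit weights \<^const>\<open>wf_digraph.\<mu>\<close> is the hop-distance; it is infinite if there is no walk,
  so a disconnected graph has infinite diameter.
\<close>

definition graph_diameter :: "('a, 'b) pre_digraph \<Rightarrow> ereal" where
  "graph_diameter G = (SUP u\<in>verts G. SUP v\<in>verts G. wf_digraph.\<mu> G (\<lambda>_. 1) u v)"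

end

theory Submission
  imports Defs
begin

text \<open>
  Cross from one face of the arrangement to another by moving inside nested regions, each of which
  is a component \<open>R\<close> of the intersection of the interiors of some subfamily \<open>S\<close>. Disks are taken
  into account one at a time: a walk in \<open>R\<close> that crosses the boundaries of a family \<open>J\<close> rarely may
  cross the boundary of a new disk \<open>D\<close> arbitrarily often, but for every component \<open>w\<close> of
  \<open>R \<inter> interior D\<close> the part between the first and the last visit of \<open>w\<close> can be replaced by a walk
  inside \<open>w\<close>. Hence, if \<open>f s m\<close> bounds the number of crossings with \<open>m\<close> boundaries inside a
  component of an intersection of \<open>s\<close> disks, then
  \<open>f s (m + 1) \<le> f s m + c (f (s + 1) m + 2)\<close>, where \<open>c\<close> is the number of the components \<open>w\<close>.

  Moreover \<open>c \<le> \<Delta> ^ s\<close>. A component \<open>w\<close> is determined by the components of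
  \<open>interior i \<inter> interior D\<close> (\<open>i \<in> S\<close>) that contain it, because two points that are connected in all
  pairwise intersections of some Jordan domains are connected in their common intersection: the
  argument of \<open>(z - a) / (z - b)\<close> has a continuous branch on the union of any two of the complements,
  and since each complement is connected and contains \<open>\<infinity>\<close>, branches normalized at \<open>\<infinity>\<close> agree.
\<close>

section \<open>Separation of two points by a union\<close>

text \<open>Borsuk's criterion: \<open>a\<close> and \<open>b\<close> lie in one component of the
  complement exactly if their direction maps to the circle are homotopic. The quotient of the two
  maps is then inessential, so it has a continuous logarithm.\<close>

lemma separation_logarithm:
  fixes a b :: complex
  assumes "compact S" "connected_component (- S) a b"
  obtains g where "continuous_on S g"
    "\<And>x. x \<in> S \<Longrightarrow> exp (\<i> * of_real (g x)) = (x - a) /\<^sub>R cmod (x - a) / ((x - b) /\<^sub>R cmod (x - b))"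
proof -
  have "a \<notin> S" "b \<notin> S"
    using assms(2) connected_component_in by blast+
  with assms have "homotopic_with_canon (\<lambda>x. True) S (sphere 0 1)
      (\<lambda>x. (x - a) /\<^sub>R cmod (x - a)) (\<lambda>x. (x - b) /\<^sub>R cmod (x - b))"
    by (simp add: Borsuk_maps_homotopic_in_connected_component_eq)
  then obtain g where "continuous_on S g"
    "\<forall>x\<in>S. (x - a) /\<^sub>R cmod (x - a) / ((x - b) /\<^sub>R cmod (x - b)) = exp (\<i> * of_real (g x))"
    by (subst (asm) homotopic_circlemaps_divide) (auto simp: inessential_eq_continuous_logarithm_circle)
  then show thesis
    by (intro that) auto
qed

text \<open>Borsuk's criterion in the other direction: one branch of the argument on all of
  \<open>S\<close> suffices to join \<open>a\<close> and \<open>b\<close>.\<close>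

lemma logarithm_imp_not_separated:
  fixes a b :: complex
  assumes "compact S" "a \<notin> S" "b \<notin> S" "continuous_on S g"
    and g: "\<And>x. x \<in> S \<Longrightarrow> exp (\<i> * of_real (g x)) = (x - a) /\<^sub>R cmod (x - a) / ((x - b) /\<^sub>R cmod (x - b))"
  shows "connected_component (- S) a b"
proof -
  have "continuous_on S (\<lambda>x. (x - a) /\<^sub>R cmod (x - a))" "continuous_on S (\<lambda>x. (x - b) /\<^sub>R cmod (x - b))"
    using assms by (intro continuous_intros; force)+
  moreover have "(\<lambda>x. (x - a) /\<^sub>R cmod (x - a)) ` S \<subseteq> sphere 0 1" "(\<lambda>x. (x - b) /\<^sub>R cmod (x - b)) ` S \<subseteq> sphere 0 1"
    using assms by (auto simp: divide_simps)
  moreover have "\<exists>g. continuous_on S g \<and>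
        (\<forall>x\<in>S. (x - a) /\<^sub>R cmod (x - a) / ((x - b) /\<^sub>R cmod (x - b)) = exp (\<i> * complex_of_real (g x)))"
    using assms(4) g by metis
  ultimately have "homotopic_with_canon (\<lambda>x. True) S (sphere 0 1)
      (\<lambda>x. (x - a) /\<^sub>R cmod (x - a)) (\<lambda>x. (x - b) /\<^sub>R cmod (x - b))"
    by (subst homotopic_circlemaps_divide) (auto simp: inessential_eq_continuous_logarithm_circle)
  with assms show ?thesis
    by (simp add: Borsuk_maps_homotopic_in_connected_component_eq)
qed

text \<open>Both branches are lifts of one map through the covering \<open>exp\<close>, and lifts
  that agree at a point of a connected set coincide.\<close>

lemma circle_logarithm_unique:
  fixes g h :: "complex \<Rightarrow> real"
  assumes "connected E" "p \<in> E" "x \<in> E" "g p = h p"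
    and "continuous_on E g" "continuous_on E h"
    and eq: "\<And>y. y \<in> E \<Longrightarrow> exp (\<i> * of_real (g y)) = exp (\<i> * of_real (h y))"
  shows "g x = h x"
proof -
  have "\<i> * of_real (g x) = \<i> * of_real (h x)"
  proof (rule covering_space_lift_unique[OF covering_space_exp_punctured_plane, where a = p and T = E
        and f = "\<lambda>y. exp (\<i> * of_real (g y))"
        and ?g1.0 = "\<lambda>y. \<i> * complex_of_real (g y)" and ?g2.0 = "\<lambda>y. \<i> * complex_of_real (h y)"])
  qed (use assms in \<open>auto intro!: continuous_intros\<close>)
  then show ?thesis by simp
qed

text \<open>Each pair \<open>E i \<union> E j\<close> carries a branch of the argument of
  \<open>(z - a) / (z - b)\<close>. Since every \<open>E i\<close> is connected and contains
  \<open>p\<close>, branches with the same value at \<open>p\<close> agree and glue to a branch on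
  the whole union.\<close>

lemma pairwise_not_separated_imp_not_separated_UN:
  fixes a b :: complex and E :: "'i \<Rightarrow> complex set"
  assumes "finite I"
    and comp: "\<And>i. i \<in> I \<Longrightarrow> compact (E i)"
    and conn: "\<And>i. i \<in> I \<Longrightarrow> connected (E i)"
    and p: "\<And>i. i \<in> I \<Longrightarrow> p \<in> E i"
    and pair: "\<And>i j. i \<in> I \<Longrightarrow> j \<in> I \<Longrightarrow> connected_component (- (E i \<union> E j)) a b"
  shows "connected_component (- (\<Union>i\<in>I. E i)) a b"
proof -
  define u where "u x = (x - a) /\<^sub>R cmod (x - a) / ((x - b) /\<^sub>R cmod (x - b))" for x
  have ab: "a \<notin> E i \<and> b \<notin> E i" if "i \<in> I" for i
    using pair[OF that that] connected_component_in by force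
  \<comment> \<open>One common value at \<open>p\<close> for all branches. The premise sets aside
    the empty family, for which \<open>u p\<close> need not lie on the circle.\<close>
  have "\<exists>\<theta>. I \<noteq> {} \<longrightarrow> exp (\<i> * complex_of_real \<theta>) = u p"
  proof (cases "I = {}")
    case False
    then obtain i where i: "i \<in> I" by blast
    obtain g where "\<And>x. x \<in> E i \<union> E i \<Longrightarrow> exp (\<i> * of_real (g x)) = u x"
      using separation_logarithm[OF _ pair[OF i i]] comp[OF i] unfolding u_def by (metis Un_absorb)
    then show ?thesis using p[OF i] by auto
  qed auto
  then obtain \<theta> where \<theta>: "I \<noteq> {} \<Longrightarrow> exp (\<i> * complex_of_real \<theta>) = u p" by blast
  have "\<exists>g. continuous_on (E i \<union> E j) g \<and> (\<forall>x\<in>E i \<union> E j. exp (\<i> * complex_of_real (g x)) = u x) \<and> g p = \<theta>"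
    if ij: "i \<in> I" "j \<in> I" for i j
  proof -
    obtain g where g: "continuous_on (E i \<union> E j) g"
      "\<And>x. x \<in> E i \<union> E j \<Longrightarrow> exp (\<i> * of_real (g x)) = u x"
      using separation_logarithm[OF compact_Un[OF comp[OF ij(1)] comp[OF ij(2)]] pair[OF ij]]
      unfolding u_def by blast
    \<comment> \<open>\<open>\<theta> - g p\<close> is a multiple of 2 pi, so shifting the branch by
      it leaves the exponential unchanged.\<close>
    have *: "exp (\<i> * of_real (\<theta> - g p)) = 1"
      using \<theta> g(2)[of p] p ij by (auto simp: right_diff_distrib exp_diff)
    have "exp (\<i> * complex_of_real (g x + (\<theta> - g p))) = u x" if "x \<in> E i \<union> E j" for x
    proof -
      have "exp (\<i> * complex_of_real (g x + (\<theta> - g p)))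
            = exp (\<i> * of_real (g x)) * exp (\<i> * of_real (\<theta> - g p))"
        by (simp flip: exp_add add: algebra_simps)
      then show ?thesis using * g(2)[OF that] by simp
    qed
    then show ?thesis
      using g(1) by (intro exI[of _ "\<lambda>x. g x + (\<theta> - g p)"]) (auto intro!: continuous_intros)
  qed
  then obtain g where g: "\<And>i j. i \<in> I \<Longrightarrow> j \<in> I \<Longrightarrow> continuous_on (E i \<union> E j) (g i j)"
    "\<And>i j x. i \<in> I \<Longrightarrow> j \<in> I \<Longrightarrow> x \<in> E i \<union> E j \<Longrightarrow> exp (\<i> * complex_of_real (g i j x)) = u x"
    "\<And>i j. i \<in> I \<Longrightarrow> j \<in> I \<Longrightarrow> g i j p = \<theta>"
    by metis
  have ag: "g i j x = g k k x" if "i \<in> I" "j \<in> I" "k \<in> {i, j}" "x \<in> E k" for i j k x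
  proof (rule circle_logarithm_unique[OF conn p \<open>x \<in> E k\<close>])
    show "k \<in> I" "k \<in> I" using that by auto
    then show "g i j p = g k k p" using g(3) that by auto
    show "continuous_on (E k) (g i j)" "continuous_on (E k) (g k k)"
      using g(1)[of i j] g(1)[of k k] that by (auto intro: continuous_on_subset)
    show "exp (\<i> * complex_of_real (g i j y)) = exp (\<i> * complex_of_real (g k k y))" if "y \<in> E k" for y
      using g(2)[of i j y] g(2)[of k k y] that \<open>k \<in> {i, j}\<close> \<open>i \<in> I\<close> \<open>j \<in> I\<close> by auto
  qed
  define h where "h x = (let i = (SOME i. i \<in> I \<and> x \<in> E i) in g i i x)" for x
  have h: "h x = g i i x" if "i \<in> I" "x \<in> E i" for i x
  proof -
    define j where "j = (SOME i. i \<in> I \<and> x \<in> E i)"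
    have j: "j \<in> I" "x \<in> E j"
      unfolding j_def using someI[of "\<lambda>i. i \<in> I \<and> x \<in> E i", OF conjI[OF that]] by auto
    \<comment> \<open>\<open>E i \<inter> E j\<close> need not be connected, so the two branches are
      not compared along it; both are compared with the branch on the union instead.\<close>
    have "g i j x = g i i x" "g i j x = g j j x"
      using ag[of i j] that j by auto
    then show ?thesis by (simp add: h_def Let_def flip: j_def)
  qed
  show ?thesis
  proof (rule logarithm_imp_not_separated)
    show "compact (\<Union>i\<in>I. E i)" using \<open>finite I\<close> comp by (rule compact_UN)
    show "a \<notin> (\<Union>i\<in>I. E i)" "b \<notin> (\<Union>i\<in>I. E i)" using ab by auto
    have "continuous_on (E i) h" if "i \<in> I" for i
      using g(1)[OF that that] h[OF that] by (metis continuous_on_cong Un_absorb)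
    then show "continuous_on (\<Union>i\<in>I. E i) h"
      using \<open>finite I\<close> comp by (intro continuous_on_closed_Union) (auto intro: compact_imp_closed)
    show "exp (\<i> * of_real (h x)) = (x - a) /\<^sub>R cmod (x - a) / ((x - b) /\<^sub>R cmod (x - b))"
      if "x \<in> (\<Union>i\<in>I. E i)" for x
      using that h g(2) by (force simp flip: u_def)
  qed
qed

section \<open>Jordan domains\<close>

text \<open>All of this is the Jordan curve theorem, once \<open>D\<close> is written as the
  complement of the outside of its curve.\<close>

lemma
  assumes "topological_disk D"
  shows compact_topological_disk: "compact D"
    and connected_interior_disk: "connected (interior D)"
    and connected_Compl_disk: "connected (- D)"
    and disk_eq_interior_Un_frontier: "D = interior D \<union> frontier D"
    and frontier_interior_disk: "frontier (interior D) = frontier D"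
    and frontier_disk_Jordan_curve:
      "\<exists>c. simple_path c \<and> pathfinish c = pathstart c \<and> frontier D = path_image c"
proof -
  obtain c where c: "simple_path c" "pathfinish c = pathstart c" "D = path_image c \<union> inside (path_image c)"
    using assms by (auto simp: topological_disk_def)
  have fr: "frontier D = path_image c"
    using c frontier_Jordan_region by blast
  note J = Jordan_inside_outside[OF c(1,2)]
  have D: "D = - outside (path_image c)"
    using c(3) union_with_inside by blast
  have "bounded D"
    using J c by (simp add: bounded_simple_path_image)
  moreover have "closed D"
    using D J by (simp add: closed_def)
  ultimately show "compact D" by (simp add: compact_eq_bounded_closed)
  have int: "interior D = inside (path_image c)"
  proof -
    have "interior D = D - frontier D"
      using \<open>closed D\<close> interior_subset[of D] by (auto simp: frontier_def)
    also have "\<dots> = inside (path_image c)"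
      using fr c(3) inside_no_overlap[of "path_image c"] by blast
    finally show ?thesis .
  qed
  show "connected (interior D)" "frontier (interior D) = frontier D"
    using J int fr by auto
  show "connected (- D)" using D J by simp
  show "D = interior D \<union> frontier D" using int fr c by auto
  show "\<exists>c. simple_path c \<and> pathfinish c = pathstart c \<and> frontier D = path_image c"
    using c fr by blast
qed

section \<open>Local connectedness of both sides of a Jordan curve\<close>

text \<open>\<open>K\<close> is what remains of the curve after a short open arc around
  \<open>z\<close> is cut out; continuity keeps that arc inside the ball, and simplicity keeps
  \<open>z\<close> off \<open>K\<close>.\<close>

lemma Jordan_curve_small_arc:
  fixes c :: "real \<Rightarrow> complex"
  assumes "simple_path c" "pathfinish c = pathstart c" "z \<in> path_image c" "e > 0"
  obtains K where "compact K" "connected K" "K \<subseteq> path_image c" "z \<notin> K" "path_image c - ball z e \<subseteq> K"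
proof -
  obtain t where t: "t \<in> {0..1}" "c t = z"
    using assms by (auto simp: path_image_def)
  \<comment> \<open>Reparametrized so that the closed curve starts and ends at \<open>z\<close>; the
    arc to remove consists of the two ends of the parameter interval.\<close>
  define d where "d = shiftpath t c"
  have d: "simple_path d" "path_image d = path_image c" "d 0 = z" "d 1 = z"
    using assms t pathstart_shiftpath[of t c] pathfinish_shiftpath[of t c]
    by (auto simp: d_def simple_path_shiftpath path_image_shiftpath pathstart_def pathfinish_def)
  then have cont: "continuous_on {0..1} d"
    by (simp add: simple_path_def path_def)
  have "\<exists>\<eta>>0. \<forall>x\<in>{0..1}. dist x s < \<eta> \<longrightarrow> dist (d x) (d s) < e" if "s \<in> {0..1}" for s
    using cont that \<open>e > 0\<close> unfolding continuous_on_iff by blast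
  from this[of 0] this[of 1] obtain \<eta>0 \<eta>1 where \<eta>: "\<eta>0 > 0" "\<eta>1 > 0"
    "\<And>x. x \<in> {0..1} \<Longrightarrow> dist x 0 < \<eta>0 \<Longrightarrow> dist (d x) (d 0) < e"
    "\<And>x. x \<in> {0..1} \<Longrightarrow> dist x 1 < \<eta>1 \<Longrightarrow> dist (d x) (d 1) < e"
    by auto
  define \<eta> where "\<eta> = min (1/2) (min \<eta>0 \<eta>1)"
  have "\<eta> > 0" "\<eta> \<le> 1/2" "\<eta> \<le> \<eta>0" "\<eta> \<le> \<eta>1" using \<eta> by (auto simp: \<eta>_def)
  show thesis
  proof
    have sub: "{\<eta>..1-\<eta>} \<subseteq> {0..1}" using \<open>\<eta> > 0\<close> by auto
    show "compact (d ` {\<eta>..1-\<eta>})" "connected (d ` {\<eta>..1-\<eta>})"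
      using continuous_on_subset[OF cont sub]
      by (auto intro: compact_continuous_image connected_continuous_image)
    show "d ` {\<eta>..1-\<eta>} \<subseteq> path_image c"
      using sub d(2) by (auto simp: path_image_def)
    show "z \<notin> d ` {\<eta>..1-\<eta>}"
    proof
      assume "z \<in> d ` {\<eta>..1-\<eta>}"
      then obtain s where s: "s \<in> {\<eta>..1-\<eta>}" "d s = d 0" using d(3) by auto
      then have "s \<in> {0..1}" using sub by blast
      then have "s = 0 \<or> s = 1"
        using d(1) s(2) unfolding simple_path_def loop_free_def by (meson atLeastAtMost_iff zero_le_one order_refl)
      then show False using s \<open>\<eta> > 0\<close> by auto
    qed
    show "path_image c - ball z e \<subseteq> d ` {\<eta>..1-\<eta>}"
    proof
      fix y assume y: "y \<in> path_image c - ball z e"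
      then have "y \<in> d ` {0..1}" using d(2) unfolding path_image_def by blast
      then obtain s where s: "s \<in> {0..1}" "y = d s" by blast
      have far: "\<not> dist (d s) z < e" using y s(2) by (simp add: dist_commute)
      have "\<not> dist s 0 < \<eta>0" "\<not> dist s 1 < \<eta>1"
        using \<eta>(3)[OF s(1)] \<eta>(4)[OF s(1)] far unfolding d(3,4) by blast+
      then have "s \<ge> \<eta>0" "1 - s \<ge> \<eta>1"
        using s(1) unfolding dist_real_def by auto
      then have "s \<in> {\<eta>..1-\<eta>}"
        using \<open>\<eta> \<le> \<eta>0\<close> \<open>\<eta> \<le> \<eta>1\<close> by simp
      then show "y \<in> d ` {\<eta>..1-\<eta>}" using s by auto
    qed
  qed
qed

text \<open>
  Janiszewski's theorem applies to the curve and to \<open>K \<union> - ball z e\<close>, where \<open>K\<close> is the curve minus a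
  small open arc around \<open>z\<close>: their intersection is the connected set \<open>K\<close>.
\<close>
lemma Jordan_complement_uniformly_connected:
  fixes c :: "real \<Rightarrow> complex"
  assumes c: "simple_path c" "pathfinish c = pathstart c" "z \<in> path_image c" and "e > 0"
  obtains d where "d > 0" "d \<le> e"
    "\<And>x y. \<lbrakk>x \<in> ball z d; y \<in> ball z d; connected_component (- path_image c) x y\<rbrakk>
       \<Longrightarrow> connected_component (ball z e - path_image c) x y"
proof -
  obtain K where K: "compact K" "connected K" "K \<subseteq> path_image c" "z \<notin> K" "path_image c - ball z e \<subseteq> K"
    by (rule Jordan_curve_small_arc[OF c \<open>e > 0\<close>])
  have "open (- K)" using K compact_imp_closed by blast
  then obtain d' where d': "d' > 0" "ball z d' \<subseteq> - K"
    using K open_contains_ball by blast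
  \<comment> \<open>The ball of radius \<open>d\<close> misses \<open>K\<close> and lies in
    \<open>ball z e\<close>, so any two of its points are joined off the second set in Janiszewski's
    theorem.\<close>
  define d where "d = min d' e"
  show thesis
  proof
    show "d > 0" "d \<le> e" using d'(1) \<open>e > 0\<close> by (simp_all add: d_def)
    fix x y assume xy: "x \<in> ball z d" "y \<in> ball z d" "connected_component (- path_image c) x y"
    define T where "T = K \<union> - ball z e"
    have "connected_component (- (path_image c \<union> T)) x y"
    proof (rule Janiszewski)
      show "compact (path_image c)" using c by (simp add: compact_simple_path_image)
      show "closed T" unfolding T_def using K by (intro closed_Un) (auto intro: compact_imp_closed)
      have "path_image c \<inter> T = K" using K(3,5) unfolding T_def by blast
      then show "connected (path_image c \<inter> T)" using K by simp
      show "connected_component (- path_image c) x y" by fact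
      have "ball z d \<subseteq> ball z d'" "ball z d \<subseteq> ball z e" by (auto simp: d_def)
      then have "ball z d \<subseteq> - T" using d'(2) unfolding T_def by blast
      then show "connected_component (- T) x y"
        using xy(1,2) connected_ball[of z d] unfolding connected_component_def by blast
    qed
    moreover have "- (path_image c \<union> T) = ball z e - path_image c"
      using K(3) unfolding T_def by blast
    ultimately show "connected_component (ball z e - path_image c) x y" by simp
  qed
qed

lemma closure_meets_open:
  "z \<in> closure S \<Longrightarrow> open N \<Longrightarrow> z \<in> N \<Longrightarrow> N \<inter> S \<noteq> {}"
  using open_Int_closure_eq_empty[of N S] by blast

lemma in_closureI:
  assumes "\<And>N. open N \<Longrightarrow> z \<in> N \<Longrightarrow> N \<inter> S \<noteq> {}"
  shows "z \<in> closure S"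
  using assms[of "- closure S"] closure_subset[of S] by blast

text \<open>Two nearby points on the same side of the boundary are joined off the curve within
  \<open>ball z e\<close>; a connected set that misses the curve cannot change sides.\<close>

lemma disk_uniformly_connected:
  assumes D: "topological_disk D" and z: "z \<in> frontier D" and "e > 0"
  obtains d where "d > 0" "d \<le> e"
    "\<And>x y. x \<in> ball z d \<inter> interior D \<Longrightarrow> y \<in> ball z d \<inter> interior D \<Longrightarrow> connected_component (ball z e \<inter> interior D) x y"
    "\<And>x y. x \<in> ball z d - D \<Longrightarrow> y \<in> ball z d - D \<Longrightarrow> connected_component (ball z e - D) x y"
proof -
  obtain c where c: "simple_path c" "pathfinish c = pathstart c" "frontier D = path_image c"
    using frontier_disk_Jordan_curve[OF D] by blast
  have z': "z \<in> path_image c" using z c(3) by simp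
  obtain d where d: "d > 0" "d \<le> e"
    "\<And>x y. \<lbrakk>x \<in> ball z d; y \<in> ball z d; connected_component (- path_image c) x y\<rbrakk>
       \<Longrightarrow> connected_component (ball z e - path_image c) x y"
    by (rule Jordan_complement_uniformly_connected[OF c(1,2) z' \<open>e > 0\<close>]) blast
  \<comment> \<open>\<open>T\<close> stands for \<open>interior D\<close> or for
    \<open>- D\<close>.\<close>
  have side: "connected_component (ball z e \<inter> T) x y"
    if T: "connected T" "T \<inter> frontier D = {}" "frontier T \<subseteq> frontier D"
      and xy: "x \<in> ball z d \<inter> T" "y \<in> ball z d \<inter> T" for T x y
  proof -
    have "connected_component (- path_image c) x y"
      unfolding connected_component_def using T(1,2) xy c(3) by blast
    then have "connected_component (ball z e - path_image c) x y"
      using d(3) xy by blast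
    then obtain C where C: "connected C" "C \<subseteq> ball z e - path_image c" "x \<in> C" "y \<in> C"
      unfolding connected_component_def by blast
    have "C \<inter> frontier T = {}" using C(2) T(3) c(3) by blast
    then have "C \<subseteq> T" using connected_Int_frontier[OF C(1), of T] C(3) xy by blast
    then show ?thesis using C unfolding connected_component_def by blast
  qed
  have di: "interior D \<inter> frontier D = {}" by (auto simp: frontier_def)
  have "frontier D \<subseteq> D" using disk_eq_interior_Un_frontier[OF D] by blast
  then have do: "- D \<inter> frontier D = {}" by blast
  show thesis
  proof
    show "d > 0" "d \<le> e" by fact+
    show "connected_component (ball z e \<inter> interior D) x y"
      if "x \<in> ball z d \<inter> interior D" "y \<in> ball z d \<inter> interior D" for x y
      using side[OF connected_interior_disk[OF D] di _ that] frontier_interior_disk[OF D] by simp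
    show "connected_component (ball z e - D) x y" if "x \<in> ball z d - D" "y \<in> ball z d - D" for x y
      using side[OF connected_Compl_disk[OF D] do, of x y] that by (simp add: frontier_complement Diff_eq)
  qed
qed

section \<open>Charts at a crossing of two boundaries\<close>

text \<open>The chart straightens the boundary to the line \<open>k w = 0\<close>, with
  \<open>k\<close> to be \<open>Re\<close> or \<open>Im\<close>. Each open half is connected and
  misses the boundary, so it lies on one side of it; \<open>s\<close> is the sign of the inner
  half.\<close>

lemma chart_half_disk:
  fixes k :: "complex \<Rightarrow> real"
  assumes D: "topological_disk D" and U: "open U" "p \<in> U" "homeomorphism U (ball 0 1) h g"
    and p: "p \<in> frontier D"
    and k: "bounded_linear k" and cut: "h ` (U \<inter> frontier D) = {w \<in> ball 0 1. k w = (0::real)}"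
  obtains s where "s \<in> {1, -1::real}" "U \<inter> interior D = g ` {w \<in> ball 0 1. s * k w > 0}"
proof -
  define P where "P s = {w \<in> ball (0::complex) 1. s * k w > 0}" for s :: real
  have homU: "g ` ball 0 1 = U" "\<And>w. w \<in> ball 0 1 \<Longrightarrow> h (g w) = w" "continuous_on (ball 0 1) g"
    "\<And>u. u \<in> U \<Longrightarrow> g (h u) = u" "h ` U = ball 0 1"
    using U(3) by (auto simp: homeomorphism_def)
  have fr: "g w \<in> frontier D \<longleftrightarrow> k w = 0" if w: "w \<in> ball 0 1" for w
  proof
    assume "g w \<in> frontier D"
    then have "h (g w) \<in> h ` (U \<inter> frontier D)" using homU(1) w by blast
    then show "k w = 0" unfolding cut using homU(2)[OF w] by simp
  next
    assume "k w = 0"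
    then have "w \<in> h ` (U \<inter> frontier D)" unfolding cut using w by simp
    then show "g w \<in> frontier D" using homU(4) by auto
  qed
  have conn: "connected (g ` P s)" for s
  proof -
    have "P s = ball 0 1 \<inter> (\<lambda>w. s * k w) -` {0<..}" by (auto simp: P_def)
    moreover have "convex ((\<lambda>w. s * k w) -` {0<..})"
      using k by (intro convex_linear_vimage bounded_linear.linear bounded_linear_const_mult) auto
    ultimately have "convex (P s)" by (simp add: convex_Int)
    moreover have "P s \<subseteq> ball 0 1" by (auto simp: P_def)
    ultimately show ?thesis
      using homU(3) by (meson connected_continuous_image continuous_on_subset convex_connected)
  qed
  have avoid: "g ` P s \<inter> frontier D = {}" for s
    using fr by (auto simp: P_def)
  have all: "U \<subseteq> g ` P 1 \<union> g ` P (-1) \<union> frontier D"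
  proof
    fix u assume "u \<in> U"
    then obtain w where w: "w \<in> ball 0 1" "u = g w" using homU(1) by blast
    show "u \<in> g ` P 1 \<union> g ` P (-1) \<union> frontier D"
    proof (cases "k w" "0::real" rule: linorder_cases)
      case equal then show ?thesis using fr w by auto
    next
      case less then have "w \<in> P (-1)" using w by (simp add: P_def)
      then show ?thesis using w by blast
    next
      case greater then have "w \<in> P 1" using w by (simp add: P_def)
      then show ?thesis using w by blast
    qed
  qed
  have dich: "g ` P s \<subseteq> interior D \<or> g ` P s \<subseteq> - D" for s
  proof -
    have "g ` P s \<inter> frontier (interior D) = {}" using avoid frontier_interior_disk[OF D] by simp
    then have "g ` P s \<subseteq> interior D \<or> g ` P s \<inter> interior D = {}"
      using connected_Int_frontier[OF conn, of s "interior D"] by blast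
    then show ?thesis using avoid[of s] disk_eq_interior_Un_frontier[OF D] by blast
  qed
  have "p \<in> frontier (interior D)" using p frontier_interior_disk[OF D] by simp
  then have "p \<in> closure (interior D)" by (simp add: frontier_def)
  then have ne1: "U \<inter> interior D \<noteq> {}" using U(1,2) by (rule closure_meets_open)
  have "p \<in> closure (- D)" using p by (simp add: frontier_closures)
  then have ne2: "U \<inter> - D \<noteq> {}" using U(1,2) by (rule closure_meets_open)
  have subU: "g ` P s \<subseteq> U" for s using homU(1) by (auto simp: P_def)
  have disj: "interior D \<inter> frontier D = {}" "- D \<inter> frontier D = {}" "interior D \<inter> - D = {}"
    using disk_eq_interior_Un_frontier[OF D] interior_subset[of D] by (auto simp: frontier_def)
  \<comment> \<open>Both halves on the same side is impossible: \<open>p\<close> is a limit of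
    points of \<open>interior D\<close> and of points of \<open>- D\<close>.\<close>
  consider "g ` P 1 \<subseteq> interior D" "g ` P (-1) \<subseteq> - D" | "g ` P (-1) \<subseteq> interior D" "g ` P 1 \<subseteq> - D"
  proof (cases "g ` P 1 \<subseteq> interior D")
    case True
    have "\<not> g ` P (-1) \<subseteq> interior D"
    proof
      assume "g ` P (-1) \<subseteq> interior D"
      then have "U \<subseteq> interior D \<union> frontier D" using True all by blast
      then show False using ne2 disj(2,3) by blast
    qed
    then show thesis using that(1) True dich by blast
  next
    case False
    then have "g ` P 1 \<subseteq> - D" using dich by blast
    moreover have "\<not> g ` P (-1) \<subseteq> - D"
    proof
      assume "g ` P (-1) \<subseteq> - D"
      then have "U \<subseteq> - D \<union> frontier D" using calculation all by blast
      then show False using ne1 disj(1,3) by blast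
    qed
    ultimately show thesis using that(2) dich by blast
  qed
  then show thesis
  proof cases
    case 1
    have "g ` P (-1) \<inter> interior D = {}" using 1(2) disj(3) by blast
    then have "U \<inter> interior D \<subseteq> g ` P 1" using all disj(1) by blast
    moreover have "g ` P 1 \<subseteq> U \<inter> interior D" using 1(1) subU by blast
    ultimately have "U \<inter> interior D = g ` P 1" by blast
    then show thesis using that[of 1] by (simp add: P_def)
  next
    case 2
    have "g ` P 1 \<inter> interior D = {}" using 2(2) disj(3) by blast
    then have "U \<inter> interior D \<subseteq> g ` P (-1)" using all disj(1) by blast
    moreover have "g ` P (-1) \<subseteq> U \<inter> interior D" using 2(1) subU by blast
    ultimately have "U \<inter> interior D = g ` P (-1)" by blast
    then show thesis using that[of "-1"] by (simp add: P_def)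
  qed
qed

text \<open>In the chart the common interior is an open quadrant of the unit disk, which is convex
  and has the origin in its closure.\<close>

lemma properly_cross_local_Int:
  assumes D1: "topological_disk D1" and D2: "topological_disk D2"
    and p1: "p \<in> frontier D1" and p2: "p \<in> frontier D2"
    and cross: "properly_cross_at (frontier D1) (frontier D2) p"
  obtains U where "open U" "p \<in> U" "connected (U \<inter> (interior D1 \<inter> interior D2))"
    "p \<in> closure (interior D1 \<inter> interior D2)"
proof -
  obtain U h g where U: "open U" "p \<in> U" "homeomorphism U (ball 0 1) h g" "h p = 0"
    and cut: "h ` (U \<inter> frontier D1) = {z \<in> ball 0 1. Im z = 0}"
      "h ` (U \<inter> frontier D2) = {z \<in> ball 0 1. Re z = 0}"
    using cross unfolding properly_cross_at_def by blast
  obtain s where s: "s \<in> {1, -1::real}" "U \<inter> interior D1 = g ` {w \<in> ball 0 1. s * Im w > 0}"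
    by (rule chart_half_disk[OF D1 U(1-3) p1 bounded_linear_Im cut(1)]) blast
  obtain t where t: "t \<in> {1, -1::real}" "U \<inter> interior D2 = g ` {w \<in> ball 0 1. t * Re w > 0}"
    by (rule chart_half_disk[OF D2 U(1-3) p2 bounded_linear_Re cut(2)]) blast
  define Q where "Q = {w \<in> ball 0 1. s * Im w > 0} \<inter> {w \<in> ball (0::complex) 1. t * Re w > 0}"
  have contg: "continuous_on (ball 0 1) g" and inv: "\<And>w. w \<in> ball 0 1 \<Longrightarrow> h (g w) = w"
    and gh: "\<And>u. u \<in> U \<Longrightarrow> g (h u) = u"
    using U(3) by (auto simp: homeomorphism_def)
  have inj: "inj_on g (ball 0 1)" by (rule inj_on_inverseI[of _ h]) (rule inv)
  have "U \<inter> (interior D1 \<inter> interior D2) = (U \<inter> interior D1) \<inter> (U \<inter> interior D2)" by blast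
  also have "\<dots> = g ` Q"
    unfolding s(2) t(2) Q_def by (subst inj_on_image_Int[OF inj]) auto
  finally have eq: "U \<inter> (interior D1 \<inter> interior D2) = g ` Q" .
  have "Q = ball 0 1 \<inter> (\<lambda>w. s * Im w) -` {0<..} \<inter> (\<lambda>w. t * Re w) -` {0<..}" by (auto simp: Q_def)
  moreover have "convex ((\<lambda>w. s * Im w) -` {0<..})" "convex ((\<lambda>w. t * Re w) -` {0<..})"
    by (intro convex_linear_vimage bounded_linear.linear bounded_linear_const_mult bounded_linear_Im
        bounded_linear_Re; simp)+
  ultimately have "convex Q" by (simp add: convex_Int)
  moreover have Qsub: "Q \<subseteq> ball 0 1" by (auto simp: Q_def)
  ultimately have conn: "connected (g ` Q)"
    by (meson contg connected_continuous_image continuous_on_subset convex_connected)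
  have "p \<in> closure (interior D1 \<inter> interior D2)"
  proof (rule closure_approachable[THEN iffD2], intro allI impI)
    fix e :: real assume "e > 0"
    have "0 \<in> ball (0::complex) 1" by simp
    then obtain d where d: "d > 0" "\<And>w. w \<in> ball 0 1 \<Longrightarrow> dist w 0 < d \<Longrightarrow> dist (g w) (g 0) < e"
      using contg \<open>e > 0\<close> unfolding continuous_on_iff by blast
    \<comment> \<open>The test point \<open>w\<close> has coordinates of absolute value
      \<open>r\<close> with the signs of the quadrant, so its norm is at most \<open>2 * r\<close>,
      which is below both \<open>d\<close> and 1.\<close>
    define r where "r = min d 1 / 3"
    have r: "r > 0" "2 * r < d" "2 * r < 1" using d(1) by (auto simp: r_def)
    define w where "w = Complex (r * t) (r * s)"
    have "cmod w \<le> \<bar>Re w\<bar> + \<bar>Im w\<bar>" by (rule cmod_le)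
    also have "\<dots> = 2 * r" using s(1) t(1) r(1) by (auto simp: w_def)
    finally have w: "cmod w < d" "cmod w < 1" using r by auto
    have "w \<in> Q" using w s(1) t(1) r(1) by (auto simp: Q_def w_def)
    then have "g w \<in> interior D1 \<inter> interior D2" using eq by blast
    moreover have "dist (g w) p < e"
      using d(2)[of w] w gh[OF U(2)] U(4) by simp
    ultimately show "\<exists>y\<in>interior D1 \<inter> interior D2. dist y p < e" by blast
  qed
  then show thesis using that U(1,2) conn eq by simp
qed

lemma connected_subset_imp_component:
  assumes "connected T" "T \<subseteq> S" "x \<in> S" "T \<noteq> {} \<Longrightarrow> x \<in> T"
  shows "\<exists>C \<in> components S. T \<subseteq> C"
  using assms by (metis componentsI connected_component_maximal empty_subsetI)

section \<open>Components of open and of closed intersections\<close>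

text \<open>Meant for a boundary point of one disk that is interior to the other: \<open>G\<close>
  is the interior of the other disk, and the uniform connectedness of \<open>D\<close> is applied in
  a ball inside \<open>G\<close>.\<close>

lemma disk_boundary_local_Int:
  assumes D: "topological_disk D" and z: "z \<in> frontier D" and G: "open G" "z \<in> G"
  obtains W C where "open W" "z \<in> W" "C \<in> components (interior D \<inter> G)"
    "W \<inter> (interior D \<inter> G) \<subseteq> C" "z \<in> closure (interior D \<inter> G)"
proof -
  obtain e where e: "e > 0" "ball z e \<subseteq> G" using G open_contains_ball by blast
  obtain d where d: "d > 0" "d \<le> e"
    "\<And>x y. x \<in> ball z d \<inter> interior D \<Longrightarrow> y \<in> ball z d \<inter> interior D \<Longrightarrow> connected_component (ball z e \<inter> interior D) x y"
    by (rule disk_uniformly_connected[OF D z e(1)]) blast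
  have "z \<in> frontier (interior D)" using z frontier_interior_disk[OF D] by simp
  then have "z \<in> closure (interior D)" by (simp add: frontier_def)
  then have ne: "N \<inter> interior D \<noteq> {}" if "open N" "z \<in> N" for N
    using that by (rule closure_meets_open)
  have "ball z d \<inter> interior D \<noteq> {}" by (rule ne) (use d(1) in auto)
  then obtain x where x: "x \<in> ball z d \<inter> interior D" by blast
  have xG: "x \<in> interior D \<inter> G" using x e(2) d(2) subset_ball[of d e z] by blast
  show thesis
  proof
    show "open (ball z d)" "z \<in> ball z d" using d(1) by auto
    show "connected_component_set (interior D \<inter> G) x \<in> components (interior D \<inter> G)"
      using xG by (rule componentsI)
    show "ball z d \<inter> (interior D \<inter> G) \<subseteq> connected_component_set (interior D \<inter> G) x"
    proof
      fix y assume y: "y \<in> ball z d \<inter> (interior D \<inter> G)"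
      have "connected_component (ball z e \<inter> interior D) x y" using d(3)[OF x] y by blast
      moreover have "ball z e \<inter> interior D \<subseteq> interior D \<inter> G" using e(2) by blast
      ultimately show "y \<in> connected_component_set (interior D \<inter> G) x"
        using connected_component_of_subset by blast
    qed
    show "z \<in> closure (interior D \<inter> G)"
    proof (rule in_closureI)
      fix V assume "open V" "z \<in> V"
      then have "(V \<inter> G) \<inter> interior D \<noteq> {}" using G by (intro ne) auto
      then show "V \<inter> (interior D \<inter> G) \<noteq> {}" by blast
    qed
  qed
qed

text \<open>Each point of the closed intersection sees exactly one component of the open
  intersection. Proper crossing excludes pinch points, where two open components would touch. The
  cases are: on both boundaries, on one of them, on neither.\<close>

lemma Int_disks_local_component:
  assumes D1: "topological_disk D1" and D2: "topological_disk D2"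
    and cross: "\<And>p. p \<in> frontier D1 \<inter> frontier D2 \<Longrightarrow> properly_cross_at (frontier D1) (frontier D2) p"
    and z: "z \<in> D1 \<inter> D2"
  shows "\<exists>W C. open W \<and> z \<in> W \<and> C \<in> components (interior D1 \<inter> interior D2)
    \<and> W \<inter> (interior D1 \<inter> interior D2) \<subseteq> C \<and> z \<in> closure C"
proof -
  let ?G = "interior D1 \<inter> interior D2"
  have "\<exists>W C. open W \<and> z \<in> W \<and> C \<in> components ?G \<and> W \<inter> ?G \<subseteq> C \<and> z \<in> closure ?G"
  proof (cases "z \<in> frontier D1"; cases "z \<in> frontier D2")
    assume "z \<in> frontier D1" "z \<in> frontier D2"
    then obtain U where U: "open U" "z \<in> U" "connected (U \<inter> ?G)" "z \<in> closure ?G"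
      using properly_cross_local_Int[OF D1 D2 _ _ cross] by blast
    then have "U \<inter> ?G \<noteq> {}" using closure_meets_open by blast
    then obtain x where "x \<in> U \<inter> ?G" by blast
    then have "\<exists>C\<in>components ?G. U \<inter> ?G \<subseteq> C"
      using connected_subset_imp_component[OF U(3), of ?G x] by blast
    then show ?thesis using U by blast
  next
    assume z1: "z \<in> frontier D1" and "z \<notin> frontier D2"
    then have "z \<in> interior D2" using z disk_eq_interior_Un_frontier[OF D2] by blast
    then show ?thesis
      by (rule disk_boundary_local_Int[OF D1 z1 open_interior]) blast
  next
    assume "z \<notin> frontier D1" and z2: "z \<in> frontier D2"
    then have "z \<in> interior D1" using z disk_eq_interior_Un_frontier[OF D1] by blast
    then have "\<exists>W C. open W \<and> z \<in> W \<and> C \<in> components (interior D2 \<inter> interior D1)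
        \<and> W \<inter> (interior D2 \<inter> interior D1) \<subseteq> C \<and> z \<in> closure (interior D2 \<inter> interior D1)"
      by (rule disk_boundary_local_Int[OF D2 z2 open_interior]) blast
    then show ?thesis by (simp add: Int_commute)
  next
    assume "z \<notin> frontier D1" "z \<notin> frontier D2"
    then have zG: "z \<in> ?G" using z disk_eq_interior_Un_frontier[OF D1] disk_eq_interior_Un_frontier[OF D2] by blast
    show ?thesis
    proof (intro exI conjI)
      show "open (connected_component_set ?G z)"
        by (rule open_connected_component) (intro open_Int open_interior)
      show "z \<in> connected_component_set ?G z" using zG by simp
      show "connected_component_set ?G z \<in> components ?G" using zG by (rule componentsI)
      show "connected_component_set ?G z \<inter> ?G \<subseteq> connected_component_set ?G z" by (rule Int_lower1)
      show "z \<in> closure ?G" using zG closure_subset by (rule subsetD[rotated])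
    qed
  qed
  then obtain W C where WC: "open W" "z \<in> W" "C \<in> components ?G" "W \<inter> ?G \<subseteq> C" "z \<in> closure ?G" by blast
  have "z \<in> closure C"
  proof (rule in_closureI)
    fix V assume V: "open V" "z \<in> V"
    have "(V \<inter> W) \<inter> ?G \<noteq> {}"
      by (rule closure_meets_open[OF WC(5)]) (use WC(1,2) V in auto)
    then show "V \<inter> C \<noteq> {}" using WC(4) by blast
  qed
  then show ?thesis using WC by blast
qed

text \<open>The overlap number counts components of closed intersections, whereas regions are cut
  out by interiors. Assigning to \<open>z\<close> the open component \<open>f z\<close> seen near it
  is locally constant on the compact set \<open>?K\<close>, which gives both finiteness and the
  bijection.\<close>

lemma card_components_Int_interior:
  assumes D1: "topological_disk D1" and D2: "topological_disk D2"
    and cross: "\<And>p. p \<in> frontier D1 \<inter> frontier D2 \<Longrightarrow> properly_cross_at (frontier D1) (frontier D2) p"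
  shows "finite (components (interior D1 \<inter> interior D2))
    \<and> card (components (interior D1 \<inter> interior D2)) = card (components (D1 \<inter> D2))"
proof -
  let ?G = "interior D1 \<inter> interior D2" and ?K = "D1 \<inter> D2"
  have GK: "?G \<subseteq> ?K" using interior_subset by blast
  have "\<forall>z\<in>?K. \<exists>W C. open W \<and> z \<in> W \<and> C \<in> components ?G \<and> W \<inter> ?G \<subseteq> C \<and> z \<in> closure C"
    using Int_disks_local_component[OF D1 D2 cross] by blast
  then obtain W f where Wf: "\<And>z. z \<in> ?K \<Longrightarrow> open (W z)" "\<And>z. z \<in> ?K \<Longrightarrow> z \<in> W z"
    "\<And>z. z \<in> ?K \<Longrightarrow> f z \<in> components ?G" "\<And>z. z \<in> ?K \<Longrightarrow> W z \<inter> ?G \<subseteq> f z"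
    "\<And>z. z \<in> ?K \<Longrightarrow> z \<in> closure (f z)"
    by metis
  have f_self: "f x = C" if "C \<in> components ?G" "x \<in> C" for x C
  proof -
    have xG: "x \<in> ?G" using in_components_subset[OF that(1)] that(2) by blast
    then have "x \<in> f x" using Wf(2,4)[of x] GK by blast
    then show ?thesis using components_nonoverlap[OF Wf(3) that(1)] that(2) xG GK by blast
  qed
  \<comment> \<open>\<open>z'\<close> is a limit of points of \<open>f z'\<close>, so the
    neighbourhood \<open>W z\<close> contains such a point, and that point lies in
    \<open>f z\<close> as well.\<close>
  have loc: "f z' = f z" if "z \<in> ?K" "z' \<in> W z \<inter> ?K" for z z'
  proof -
    have "W z \<inter> f z' \<noteq> {}"
      by (rule closure_meets_open[of z']) (use that Wf(1)[of z] Wf(5)[of z'] in blast)+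
    then obtain y where y: "y \<in> f z'" "y \<in> W z" by blast
    then have "y \<in> ?G" using in_components_subset[OF Wf(3)[of z']] that by blast
    then have "y \<in> f z" using y Wf(4)[OF that(1)] by blast
    then show ?thesis using components_nonoverlap[OF Wf(3)[of z'] Wf(3)[of z]] y that by blast
  qed
  have "compact ?K"
    using compact_topological_disk[OF D1] compact_topological_disk[OF D2] by (rule compact_Int)
  then obtain Z where Z: "Z \<subseteq> ?K" "finite Z" "?K \<subseteq> (\<Union>z\<in>Z. W z)"
    by (rule compactE_image[of ?K ?K W]) (use Wf(1,2) in blast)+
  \<comment> \<open>By compactness finitely many \<open>W z\<close> cover \<open>?K\<close>, and on
    each of them \<open>f\<close> takes a single value.\<close>
  have "components ?G \<subseteq> f ` Z"
  proof
    fix C assume C: "C \<in> components ?G"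
    obtain x where x: "x \<in> C" using in_components_nonempty[OF C] by blast
    then have xK: "x \<in> ?K" using in_components_subset[OF C] GK by blast
    then obtain z where z: "z \<in> Z" "x \<in> W z" using Z(3) by blast
    then have "f x = f z" using loc[of z x] Z(1) xK by blast
    then show "C \<in> f ` Z" using f_self[OF C x] z(1) by blast
  qed
  then have fin: "finite (components ?G)" using Z(2) finite_subset by blast
  \<comment> \<open>The closed component around \<open>C\<close>, found from an arbitrary point of
    \<open>C\<close>.\<close>
  define \<psi> where "\<psi> C = connected_component_set ?K (SOME x. x \<in> C)" for C
  have some: "(SOME x. x \<in> C) \<in> C" if "C \<in> components ?G" for C
    using in_components_nonempty[OF that] by (simp add: some_in_eq)
  have "bij_betw \<psi> (components ?G) (components ?K)"
  proof (rule bij_betwI')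
    fix C C' assume C: "C \<in> components ?G" "C' \<in> components ?G"
    let ?x = "SOME x. x \<in> C" and ?y = "SOME x. x \<in> C'"
    have xy: "?x \<in> ?K" "?y \<in> ?K"
      using some[OF C(1)] some[OF C(2)] in_components_subset[OF C(1)] in_components_subset[OF C(2)] GK by blast+
    show "(\<psi> C = \<psi> C') = (C = C')"
    proof
      assume "\<psi> C = \<psi> C'"
      then have "connected_component ?K ?x ?y"
        unfolding \<psi>_def connected_component_eq_eq using xy by blast
      then obtain T where T: "connected T" "T \<subseteq> ?K" "?x \<in> T" "?y \<in> T"
        unfolding connected_component_def by blast
      \<comment> \<open>A locally constant function is constant on the connected set
        \<open>T\<close>; this gives injectivity of \<open>\<psi>\<close>.\<close>
      have "f ?x = f ?y"
      proof (rule connected_local_const[OF T(1,3,4)], rule ballI)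
        fix a assume a: "a \<in> T"
        then have "f a = f b" if "b \<in> T" "b \<in> W a" for b using loc[of a b] T(2) that by auto
        then show "\<forall>\<^sub>F b in at a within T. f a = f b"
          unfolding eventually_at_topological using Wf(1,2)[of a] a T(2) by blast
      qed
      then show "C = C'" using f_self some C by metis
    qed simp
  next
    fix C assume C: "C \<in> components ?G"
    then show "\<psi> C \<in> components ?K"
      unfolding \<psi>_def using some[OF C] in_components_subset[OF C] GK by (intro componentsI) blast
  next
    fix B assume B: "B \<in> components ?K"
    then obtain z where z: "z \<in> B" using in_components_nonempty by blast
    have zK: "z \<in> ?K" using in_components_subset[OF B] z by blast
    have C: "f z \<in> components ?G" using Wf(3)[OF zK] .
    have "closed ?K" using \<open>compact ?K\<close> compact_imp_closed by blast
    moreover have "f z \<subseteq> ?K" using in_components_subset[OF C] GK by blast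
    ultimately have clK: "closure (f z) \<subseteq> ?K" by (intro closure_minimal)
    have "connected (closure (f z))" using in_components_connected[OF C] by (rule connected_imp_connected_closure)
    \<comment> \<open>Surjectivity: the closure of \<open>f z\<close> is connected, stays in the
      closed set \<open>?K\<close> and contains the point \<open>z\<close> of
      \<open>B\<close>.\<close>
    then have "closure (f z) \<subseteq> B"
      using components_maximal[OF B _ clK] z Wf(5)[OF zK] by blast
    then have inB: "(SOME x. x \<in> f z) \<in> B" using some[OF C] closure_subset by blast
    obtain b where b: "B = connected_component_set ?K b" using B componentsE by metis
    have "B = \<psi> (f z)"
      unfolding \<psi>_def using inB connected_component_eq[of _ ?K b] b by auto
    then show "\<exists>C\<in>components ?G. B = \<psi> C" using C by blast
  qed
  then show ?thesis using fin bij_betw_same_card by blast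
qed

section \<open>Components of intersections of disks\<close>

lemma connected_Compl_interior_disk:
  assumes "topological_disk D"
  shows "connected (- interior D)"
  using connected_imp_connected_closure[OF connected_Compl_disk[OF assms]] by (simp add: closure_complement)

text \<open>Gluing of branches needs compact sets, so a large ball replaces the plane with its point
  at infinity. The nearest-point projection maps the connected set \<open>- interior D\<close> onto
  the claimed set, since points outside the ball go to the sphere, which misses
  \<open>D\<close>.\<close>

lemma connected_cball_diff_interior_disk:
  assumes D: "topological_disk D" and "D \<subseteq> ball 0 M" "M > 0"
  shows "connected (cball 0 M - interior D)"
proof -
  let ?c = "closest_point (cball (0::complex) M)"
  have "?c ` (- interior D) = cball 0 M - interior D"
  proof (rule set_eqI, rule iffI)
    fix y assume "y \<in> ?c ` (- interior D)"
    then obtain x where x: "x \<notin> interior D" "y = ?c x" by blast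
    show "y \<in> cball 0 M - interior D"
    proof (cases "x \<in> cball 0 M")
      case True
      then have "?c x = x" by (rule closest_point_self)
      then show ?thesis using True x by simp
    next
      case False
      have "\<exists>z. z \<in> cball (0::complex) M" using \<open>M > 0\<close> by (intro exI[of _ 0]) simp
      then have "cball (0::complex) M \<noteq> {}" by blast
      then have "y \<in> cball 0 M" unfolding x(2) by (intro closest_point_in_set) auto
      moreover have "y \<notin> ball 0 M"
      proof -
        have ne_int: "interior (cball (0::complex) M) \<noteq> {}" using \<open>M > 0\<close> by simp
        have "?c x \<in> frontier (cball 0 M)"
          using closest_point_in_rel_frontier[of "cball (0::complex) M" x] ne_int False
          by (simp add: affine_hull_nonempty_interior rel_interior_nonempty_interior rel_frontier_nonempty_interior)
        then show ?thesis unfolding x(2) by simp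
      qed
      moreover have "interior D \<subseteq> ball 0 M" using assms(2) interior_subset by blast
      ultimately show ?thesis by blast
    qed
  next
    fix y assume y: "y \<in> cball 0 M - interior D"
    then have "?c y = y" by (intro closest_point_self) simp
    then show "y \<in> ?c ` (- interior D)" using y by (intro image_eqI[of _ _ y]) auto
  qed
  moreover have "connected (?c ` (- interior D))"
    using \<open>M > 0\<close> by (intro connected_continuous_image connected_Compl_interior_disk D continuous_on_closest_point) auto
  ultimately show ?thesis by simp
qed

text \<open>The gluing lemma applies to the compact complements \<open>E i\<close> within a large
  ball. They all contain the bounding sphere, whose point \<open>M\<close> serves as the common base
  point.\<close>

lemma connected_component_INT_interior_disks:
  assumes "finite I" and disk: "\<And>i. i \<in> I \<Longrightarrow> topological_disk (D i)"
    and pair: "\<And>i j. i \<in> I \<Longrightarrow> j \<in> I \<Longrightarrow> connected_component (interior (D i) \<inter> interior (D j)) x y"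
  shows "connected_component (\<Inter>i\<in>I. interior (D i)) x y"
proof (cases "I = {}")
  case True
  then show ?thesis using connected_UNIV unfolding connected_component_def by auto
next
  case False
  then obtain k where k: "k \<in> I" by blast
  have "bounded (\<Union>i\<in>I. D i)"
    using \<open>finite I\<close> compact_topological_disk[OF disk] by (intro bounded_UN) (auto intro: compact_imp_bounded)
  then obtain M where M: "M > 0" "(\<Union>i\<in>I. D i) \<subseteq> ball 0 M"
    by (metis bounded_subset_ballD)
  then have sub: "D i \<subseteq> ball 0 M" if "i \<in> I" for i using that by blast
  define E where "E i = cball 0 M - interior (D i)" for i
  have int_sub: "interior (D i) \<subseteq> ball 0 M" if "i \<in> I" for i
    using sub[OF that] interior_subset by blast
  have sphere_E: "sphere 0 M \<subseteq> E i" if "i \<in> I" for i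
    using int_sub[OF that] unfolding E_def by fastforce
  have "connected_component (- (\<Union>i\<in>I. E i)) x y"
  proof (rule pairwise_not_separated_imp_not_separated_UN[OF \<open>finite I\<close>])
    fix i assume i: "i \<in> I"
    show "compact (E i)" unfolding E_def by (intro compact_diff) auto
    show "connected (E i)"
      unfolding E_def by (rule connected_cball_diff_interior_disk[OF disk[OF i] sub[OF i] M(1)])
    have "complex_of_real M \<in> sphere 0 M" using M(1) by simp
    then show "complex_of_real M \<in> E i" using sphere_E[OF i] by blast
  next
    fix i j assume ij: "i \<in> I" "j \<in> I"
    have "interior (D i) \<inter> interior (D j) \<subseteq> - (E i \<union> E j)" unfolding E_def by blast
    then show "connected_component (- (E i \<union> E j)) x y"
      using pair[OF ij] connected_component_of_subset by blast
  qed
  then obtain C where C: "connected C" "C \<subseteq> - (\<Union>i\<in>I. E i)" "x \<in> C" "y \<in> C"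
    unfolding connected_component_def by blast
  \<comment> \<open>The complement of the sets \<open>E i\<close> also includes the exterior of the
    ball; starting at \<open>x\<close> in the ball, \<open>C\<close> cannot reach it without meeting
    the sphere.\<close>
  have "C \<inter> sphere 0 M = {}" using C(2) sphere_E[OF k] k by blast
  then have "C \<inter> frontier (cball 0 M) = {}" by simp
  moreover have "x \<in> interior (D k)"
    using connected_component_in[OF pair[OF k k]] by blast
  then have "x \<in> cball 0 M" using int_sub[OF k] ball_subset_cball by blast
  ultimately have "C \<subseteq> cball 0 M"
    using connected_Int_frontier[of C "cball 0 M"] C(1,3) by blast
  then have "C \<subseteq> (\<Inter>i\<in>I. interior (D i))" using C(2) unfolding E_def by blast
  then show ?thesis using C unfolding connected_component_def by blast
qed

text \<open>A component \<open>w\<close> is recovered from the tuple of components of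
  \<open>interior i \<inter> interior d\<close> that contain it, and each of the
  \<open>card S\<close> entries has at most \<open>\<Delta>\<close> values.\<close>

lemma card_components_Int_le:
  assumes "finite S" "\<And>i. i \<in> S \<Longrightarrow> topological_disk i" "topological_disk d"
    and cnt: "\<And>i. i \<in> S \<Longrightarrow> finite (components (interior i \<inter> interior d))
                 \<and> card (components (interior i \<inter> interior d)) \<le> \<Delta>"
    and R: "R \<in> components (\<Inter>i\<in>S. interior i)"
  shows "finite (components (R \<inter> interior d)) \<and> card (components (R \<inter> interior d)) \<le> \<Delta> ^ card S"
proof -
  define P where "P = PiE S (\<lambda>i. components (interior i \<inter> interior d))"
  have finP: "finite P" unfolding P_def using assms(1) cnt by (intro finite_PiE) auto
  have "card P = (\<Prod>i\<in>S. card (components (interior i \<inter> interior d)))"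
    unfolding P_def using assms(1) by (rule card_PiE)
  also have "\<dots> \<le> (\<Prod>i\<in>S. \<Delta>)" using cnt by (intro prod_mono) auto
  finally have cardP: "card P \<le> \<Delta> ^ card S" by simp
  define pick where "pick w = (SOME x. x \<in> w)" for w :: "complex set"
  have pick: "pick w \<in> w" if "w \<in> components (R \<inter> interior d)" for w
    using in_components_nonempty[OF that] unfolding pick_def by (simp add: some_in_eq)
  define F where "F w = (\<lambda>i\<in>S. connected_component_set (interior i \<inter> interior d) (pick w))" for w
  have Rsub: "R \<subseteq> interior i" if "i \<in> S" for i
    using in_components_subset[OF R] that by blast
  have pick': "pick w \<in> R" "pick w \<in> interior d" if "w \<in> components (R \<inter> interior d)" for w
    using pick[OF that] in_components_subset[OF that] by blast+
  have "F ` components (R \<inter> interior d) \<subseteq> P"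
    unfolding F_def P_def using pick' subsetD[OF Rsub] by (auto intro!: componentsI)
  moreover have "inj_on F (components (R \<inter> interior d))"
  proof (rule inj_onI)
    fix w w' assume w: "w \<in> components (R \<inter> interior d)" "w' \<in> components (R \<inter> interior d)" "F w = F w'"
    let ?x = "pick w" and ?y = "pick w'"
    have Sd: "connected_component (interior i \<inter> interior d) ?x ?y" if "i \<in> S" for i
    proof -
      have "connected_component_set (interior i \<inter> interior d) ?x = connected_component_set (interior i \<inter> interior d) ?y"
        using fun_cong[OF w(3), of i] that by (simp add: F_def)
      then show ?thesis using pick'[OF w(1)] Rsub[OF that] by (auto simp: connected_component_eq_eq)
    qed
    \<comment> \<open>Pairwise connections: equal tuples settle the pairs of some \<open>i\<close>
      with \<open>d\<close>, connectedness of \<open>R\<close> the pairs within \<open>S\<close>,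
      and connectedness of \<open>interior d\<close> the remaining one.\<close>
    have "connected_component (\<Inter>i\<in>insert d S. interior i) ?x ?y"
    proof (rule connected_component_INT_interior_disks)
      fix i j assume ij: "i \<in> insert d S" "j \<in> insert d S"
      have dd: "connected_component (interior d) ?x ?y"
        using connected_interior_disk[OF assms(3)] pick' w unfolding connected_component_def by blast
      have RR: "connected_component R ?x ?y"
        using in_components_connected[OF R] pick' w unfolding connected_component_def by blast
      show "connected_component (interior i \<inter> interior j) ?x ?y"
      proof (cases "i = d"; cases "j = d")
        assume "i = d" "j = d" then show ?thesis using dd by simp
      next
        assume "i = d" "j \<noteq> d" then show ?thesis using Sd[of j] ij by (simp add: Int_commute)
      next
        assume "i \<noteq> d" "j = d" then show ?thesis using Sd[of i] ij by simp
      next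
        assume "i \<noteq> d" "j \<noteq> d"
        then have "R \<subseteq> interior i \<inter> interior j" using Rsub ij by blast
        then show ?thesis using RR connected_component_of_subset by blast
      qed
    qed (use assms in auto)
    then obtain C where C: "connected C" "C \<subseteq> (\<Inter>i\<in>insert d S. interior i)" "?x \<in> C" "?y \<in> C"
      unfolding connected_component_def by blast
    have "C \<subseteq> R"
      using C pick'(1)[OF w(1)] by (intro components_maximal[OF R]) auto
    then have "C \<subseteq> R \<inter> interior d" using C(2) by blast
    then have "C \<subseteq> w"
      using components_maximal[OF w(1) C(1)] pick[OF w(1)] C(3) by blast
    then show "w = w'"
      using components_nonoverlap[OF w(1,2)] pick[OF w(2)] C(4) by blast
  qed
  ultimately show ?thesis
    using finP cardP card_inj_on_le[of F "components (R \<inter> interior d)" P] inj_on_finite[of F] by auto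
qed

text \<open>This lets the recursion pass from \<open>S\<close> to \<open>insert d S\<close>: a
  component cut out of a region is again a region.\<close>

lemma component_Int_interior:
  assumes R: "R \<in> components (\<Inter>i\<in>S. interior i)" and w: "w \<in> components (R \<inter> interior d)"
  shows "w \<in> components (\<Inter>i\<in>insert d S. interior i)"
  unfolding in_components_maximal
proof (intro conjI allI impI)
  show "w \<noteq> {}" using w by (rule in_components_nonempty)
  show "w \<subseteq> (\<Inter>i\<in>insert d S. interior i)"
    using in_components_subset[OF w] in_components_subset[OF R] by blast
  show "connected w" using w by (rule in_components_connected)
  fix T assume T: "T \<noteq> {} \<and> w \<subseteq> T \<and> T \<subseteq> (\<Inter>i\<in>insert d S. interior i) \<and> connected T"
  have "R \<inter> T \<noteq> {}"
    using T in_components_nonempty[OF w] in_components_subset[OF w] by blast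
  then have "T \<subseteq> R" using T by (intro components_maximal[OF R]) auto
  then have "T \<subseteq> w" using T in_components_nonempty[OF w] by (intro components_maximal[OF w]) auto
  then show "T = w" using T by blast
qed

section \<open>Walks with labelled edges\<close>

text \<open>
  \<open>lwalk E J A k x y\<close>: some walk from \<open>x\<close> to \<open>y\<close> through vertices in \<open>A\<close> uses at most \<open>k\<close> edges with
  label in \<open>J\<close>. Edges with other labels may be counted as well, and \<open>k\<close> is only an upper bound.
\<close>

inductive lwalk :: "('l \<Rightarrow> 'v \<Rightarrow> 'v \<Rightarrow> bool) \<Rightarrow> 'l set \<Rightarrow> 'v set \<Rightarrow> nat \<Rightarrow> 'v \<Rightarrow> 'v \<Rightarrow> bool"
  for E J A where
  nil: "x \<in> A \<Longrightarrow> lwalk E J A k x x"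
| free: "E l x y \<Longrightarrow> l \<notin> J \<Longrightarrow> x \<in> A \<Longrightarrow> lwalk E J A k y z \<Longrightarrow> lwalk E J A k x z"
| step: "E l x y \<Longrightarrow> x \<in> A \<Longrightarrow> lwalk E J A k y z \<Longrightarrow> lwalk E J A (Suc k) x z"

lemma lwalk_start: "lwalk E J A k x y \<Longrightarrow> x \<in> A"
  by (induction rule: lwalk.induct) auto

lemma lwalk_append:
  "lwalk E J A k x y \<Longrightarrow> lwalk E J A m y z \<Longrightarrow> lwalk E J A (k + m) x z"
proof (induction arbitrary: m rule: lwalk.induct)
  case (nil x k)
  have "lwalk E J A (k + m) x z" if "lwalk E J A m x z" for k m x z
    using that
  proof (induction rule: lwalk.induct)
    case (nil x m) then show ?case by (intro lwalk.nil)
  next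
    case (free l x y m z) then show ?case by (intro lwalk.free[of E l x y])
  next
    case (step l x y m z)
    then have "lwalk E J A (Suc (k + m)) x z" by (intro lwalk.step[of E l x y])
    then show ?case by simp
  qed
  then show ?case using nil by blast
next
  case (free l x y k w) then show ?case by (intro lwalk.free[of E l x y]) auto
next
  case (step l x y k w)
  then have "lwalk E J A (Suc (k + m)) x z" by (intro lwalk.step[of E l x y]) auto
  then show ?case by simp
qed

lemma lwalk_mono: "lwalk E J A k x y \<Longrightarrow> k \<le> k' \<Longrightarrow> lwalk E J A k' x y"
  \<comment> \<open>The trivial walk is available for every budget, so it supplies the slack
    \<open>k' - k\<close>.\<close>
  using lwalk_append[OF lwalk.nil[of x A E J "k' - k"], of k y] lwalk_start[of E J A k x y] by simp

text \<open>No edge labelled \<open>j\<close> joins vertices of \<open>A'\<close>, so declaring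
  \<open>j\<close> a counted label makes no edge of the walk more expensive.\<close>

lemma lwalk_insert_label:
  assumes "lwalk E J A' k x y" "A' \<subseteq> A" "\<And>x y. x \<in> A' \<Longrightarrow> y \<in> A' \<Longrightarrow> \<not> E j x y"
  shows "lwalk E (insert j J) A k x y"
  using assms(1)
proof (induction rule: lwalk.induct)
  case (nil x k) then show ?case using assms(2) by (intro lwalk.nil) auto
next
  case (free l x y k z)
  then have "l \<noteq> j" using assms(3) lwalk_start by metis
  then show ?case using free assms(2) by (intro lwalk.free[of E l x y]) auto
next
  case (step l x y k z)
  then show ?case using assms(2) by (intro lwalk.step[of E l x y]) auto
qed

text \<open>If the walk meets \<open>P\<close>, it is cut at its last vertex \<open>b\<close> in
  \<open>P\<close>; \<open>b = z\<close> covers a walk that ends in \<open>P\<close>.\<close>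

lemma lwalk_last_visit:
  assumes "lwalk E J A k x z"
  shows "lwalk E J (A - P) k x z \<or>
    (\<exists>b \<in> P \<inter> A. b = z \<or> (\<exists>l y m. E l b y \<and> m \<le> k \<and> lwalk E J (A - P) m y z))"
  using assms
proof (induction rule: lwalk.induct)
  case (nil x k) then show ?case by (cases "x \<in> P") (auto intro: lwalk.nil)
next
  case (free l x y k z)
  show ?case
  proof (cases "lwalk E J (A - P) k y z")
    case True
    then show ?thesis using free(1-3) by (cases "x \<in> P") (auto intro: lwalk.free)
  next
    case False
    then show ?thesis using free.IH by blast
  qed
next
  case (step l x y k z)
  show ?case
  proof (cases "lwalk E J (A - P) k y z")
    case True
    show ?thesis
    proof (cases "x \<in> P")
      case True
      then show ?thesis
        using step(1,2) \<open>lwalk E J (A - P) k y z\<close> le_SucI[OF order_refl] by blast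
    next
      case False
      then show ?thesis using lwalk.step[OF step(1) _ \<open>lwalk E J (A - P) k y z\<close>] step(2) by blast
    qed
  next
    case False
    then show ?thesis using step.IH le_SucI by blast
  qed
qed

text \<open>The colour of a vertex is the component of the new disk's part that contains it, with
  \<open>None\<close> outside the disk. From the first visit of a colour the walk jumps to the last
  one, so each colour is used once and costs at most \<open>g + 2\<close>: the inner walk, an edge
  in and an edge out. Induction is on the number of colours still available.\<close>

lemma lwalk_shortcut:
  fixes color :: "'v \<Rightarrow> 'c option"
  assumes inner: "\<And>a b w. a \<in> A \<Longrightarrow> b \<in> A \<Longrightarrow> color a = Some w \<Longrightarrow> color b = Some w \<Longrightarrow> lwalk E (insert j J) A g a b"
    and outer: "\<And>x y. x \<in> A \<Longrightarrow> y \<in> A \<Longrightarrow> color x = None \<Longrightarrow> color y = None \<Longrightarrow> \<not> E j x y"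
    and "finite C" "lwalk E J {v \<in> A. color v \<in> insert None (Some ` C)} k x z"
  shows "\<exists>m. m + (if color x = None then 0 else 1) \<le> k + card C * (g + 2) \<and> lwalk E (insert j J) A m x z"
  using assms(3,4)
proof (induction "card C" arbitrary: C k x z rule: less_induct)
  case less
  let ?A = "\<lambda>C. {v \<in> A. color v \<in> insert None (Some ` C)}"
  \<comment> \<open>The extra unit at a coloured start is reserved for the edge by which that colour
    was entered.\<close>
  let ?goal = "\<lambda>k x z. \<exists>m. m + (if color x = None then 0 else 1) \<le> k + card C * (g + 2) \<and> lwalk E (insert j J) A m x z"
  have colored: "?goal k x z" if walk: "lwalk E J (?A C) k x z" and w: "color x = Some w" for k x z w
  proof -
    have xA: "x \<in> A" "w \<in> C" using lwalk_start[OF walk] w by auto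
    then have card: "card C = Suc (card (C - {w}))" using less.prems(1) by (metis card_Suc_Diff1)
    let ?P = "{v. color v = Some w}"
    have "\<not> lwalk E J (?A C - ?P) k x z" using lwalk_start[of E J "?A C - ?P" k x z] w by blast
    then obtain b where b: "b \<in> ?P \<inter> ?A C"
      "b = z \<or> (\<exists>l y m. E l b y \<and> m \<le> k \<and> lwalk E J (?A C - ?P) m y z)"
      using lwalk_last_visit[OF walk, of ?P] by blast
    \<comment> \<open>The whole stretch from \<open>x\<close> to the last vertex \<open>b\<close> of
      its colour is replaced by an inner walk; afterwards \<open>w\<close> no longer occurs.\<close>
    have xb: "lwalk E (insert j J) A g x b" using inner[OF xA(1), of b w] w b(1) by blast
    show ?thesis
    proof (cases "b = z")
      case True
      then show ?thesis using xb card w by (intro exI[of _ g]) auto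
    next
      case False
      then obtain l y m where y: "E l b y" "m \<le> k" "lwalk E J (?A C - ?P) m y z" using b(2) by blast
      have "?A C - ?P = ?A (C - {w})" by auto
      then have "lwalk E J (?A (C - {w})) m y z" using y(3) by simp
      moreover have "card (C - {w}) < card C" "finite (C - {w})" using card less.prems(1) by auto
      ultimately obtain m' where "m' + (if color y = None then 0 else 1) \<le> m + card (C - {w}) * (g + 2)"
        and m'_walk: "lwalk E (insert j J) A m' y z"
        using less.hyps[of "C - {w}" m y z] by blast
      then have m'_le: "m' \<le> m + card (C - {w}) * (g + 2)" by linarith
      \<comment> \<open>The edge that leaves \<open>b\<close> is counted whatever its label.\<close>
      have "lwalk E (insert j J) A (Suc m') b z"
        using b(1) by (intro lwalk.step[OF y(1) _ m'_walk]) auto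
      then have "lwalk E (insert j J) A (g + Suc m') x z" using lwalk_append[OF xb] by blast
      then show ?thesis using m'_le y(2) card w by (intro exI[of _ "g + Suc m'"]) auto
    qed
  qed
  show ?case
    using less.prems(2)
  proof (induction rule: lwalk.induct)
    case (nil x k)
    show ?case
    proof (cases "color x")
      case None
      then show ?thesis using nil by (intro exI[of _ 0]) (auto intro: lwalk.nil)
    next
      case (Some w)
      then show ?thesis using colored[OF lwalk.nil[OF nil]] by blast
    qed
  next
    case (free l x y k z)
    have walk: "lwalk E J (?A C) k x z" by (rule lwalk.free[OF free(1-4)])
    obtain m where m: "m + (if color y = None then 0 else 1) \<le> k + card C * (g + 2)" "lwalk E (insert j J) A m y z"
      using free.IH by blast
    have xA: "x \<in> A" "y \<in> A" using free(3) lwalk_start[OF free(4)] by auto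
    show ?case
    proof (cases "color x")
      case x: None
      show ?thesis
      proof (cases "color y")
        case None
        \<comment> \<open>Outside the new disk no boundary \<open>j\<close> is crossed, so the edge
          stays free.\<close>
        then have "l \<noteq> j" using outer[OF xA x] free(1) by blast
        then have "lwalk E (insert j J) A m x z"
          using free(2) xA m(2) by (intro lwalk.free[of E l x y] free(1)) auto
        then show ?thesis using m(1) x None by auto
      next
        case (Some w)
        \<comment> \<open>The edge entering the colour may now be labelled \<open>j\<close>; the
          unit reserved at \<open>y\<close> pays for it.\<close>
        have "lwalk E (insert j J) A (Suc m) x z" by (rule lwalk.step[OF free(1) xA(1) m(2)])
        then show ?thesis using m(1) x Some by (intro exI[of _ "Suc m"]) auto
      qed
    next
      case (Some w)
      then show ?thesis using colored[OF walk] by blast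
    qed
  next
    case (step l x y k z)
    have walk: "lwalk E J (?A C) (Suc k) x z" by (rule lwalk.step[OF step(1-3)])
    obtain m where m: "m + (if color y = None then 0 else 1) \<le> k + card C * (g + 2)" "lwalk E (insert j J) A m y z"
      using step.IH by blast
    have xA: "x \<in> A" using step(2) by auto
    show ?case
    proof (cases "color x")
      case x: None
      have "lwalk E (insert j J) A (Suc m) x z" by (rule lwalk.step[OF step(1) xA m(2)])
      then show ?thesis using m(1) x by (intro exI[of _ "Suc m"]) (auto split: if_splits)
    next
      case (Some w)
      then show ?thesis using colored[OF walk] by blast
    qed
  qed
qed

section \<open>The crossing recursion\<close>

fun crossing_bound :: "nat \<Rightarrow> nat \<Rightarrow> nat \<Rightarrow> nat" where
  "crossing_bound \<Delta> s 0 = 0"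
| "crossing_bound \<Delta> s (Suc m) = crossing_bound \<Delta> s m + \<Delta> ^ s * (crossing_bound \<Delta> (Suc s) m + 2)"

lemma Suc_choose_two_exponent: "Suc m * (Suc m - 1) div 2 = m * (m - 1) div 2 + m"
proof -
  have "Suc m * (Suc m - 1) = m * (m - 1) + m * 2" by (cases m) auto
  then show ?thesis by (simp del: mult_Suc)
qed

text \<open>Adding 2 makes the recursion homogeneous, and each unrolling then costs a power of
  \<open>\<Delta> + 1\<close>. The exponent is the sum of \<open>s + i\<close> over
  \<open>i < m\<close>.\<close>

lemma crossing_bound_pos:
  "s > 0 \<Longrightarrow> crossing_bound \<Delta> s m + 2 \<le> 2 * (\<Delta> + 1) ^ (s * m + m * (m - 1) div 2)"
proof (induction m arbitrary: s)
  case 0 then show ?case by simp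
next
  case (Suc m)
  define e b where "e = m * (m - 1) div 2" and "b = \<Delta> + 1"
  \<comment> \<open>This is where \<open>s > 0\<close> enters: for \<open>s = 0\<close> the left
    side would be 2.\<close>
  have pw: "\<Delta> ^ s + 1 \<le> b ^ s"
  proof -
    obtain s' where s': "s = Suc s'" using Suc.prems gr0_implies_Suc by blast
    have "\<Delta> ^ s' \<le> b ^ s'" "1 \<le> b ^ s'" by (auto simp: b_def power_mono)
    then have "\<Delta> * \<Delta> ^ s' + 1 \<le> \<Delta> * b ^ s' + b ^ s'" by (intro add_mono mult_left_mono) auto
    then show ?thesis by (simp add: s' b_def)
  qed
  have "crossing_bound \<Delta> s (Suc m) + 2 = (crossing_bound \<Delta> s m + 2) + \<Delta> ^ s * (crossing_bound \<Delta> (Suc s) m + 2)"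
    by simp
  also have "\<dots> \<le> 2 * b ^ (s * m + e) + \<Delta> ^ s * (2 * b ^ (Suc s * m + e))"
    using Suc.IH[of s] Suc.IH[of "Suc s"] Suc.prems unfolding e_def b_def
    by (intro add_mono mult_left_mono) auto
  also have "\<dots> = 2 * b ^ (s * m + e) * (1 + \<Delta> ^ s * b ^ m)"
    by (simp add: power_add algebra_simps)
  also have "\<dots> \<le> 2 * b ^ (s * m + e) * (b ^ s * b ^ m)"
  proof (rule mult_left_mono)
    have "1 \<le> b ^ m" by (simp add: b_def)
    then have "1 + \<Delta> ^ s * b ^ m \<le> (\<Delta> ^ s + 1) * b ^ m" by simp
    also have "\<dots> \<le> b ^ s * b ^ m" using pw by (rule mult_right_mono) simp
    finally show "1 + \<Delta> ^ s * b ^ m \<le> b ^ s * b ^ m" .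
  qed simp
  also have "\<dots> = 2 * b ^ (s * Suc m + (e + m))" by (simp add: power_add algebra_simps)
  finally show ?case unfolding Suc_choose_two_exponent e_def b_def .
qed

text \<open>At \<open>s = 0\<close> the factor \<open>\<Delta> ^ s\<close> is 1, so the recursion is
  a sum of \<open>m\<close> terms, each at most twice the final power.\<close>

lemma crossing_bound_zero:
  "crossing_bound \<Delta> 0 m \<le> 2 * m * (\<Delta> + 1) ^ (m * (m - 1) div 2)"
proof (induction m)
  case (Suc m)
  define e b where "e = m * (m - 1) div 2" and "b = \<Delta> + 1"
  have "crossing_bound \<Delta> 0 (Suc m) = crossing_bound \<Delta> 0 m + (crossing_bound \<Delta> 1 m + 2)" by simp
  also have "\<dots> \<le> 2 * m * b ^ e + 2 * b ^ (m + e)"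
    using Suc.IH crossing_bound_pos[of 1 \<Delta> m] unfolding e_def b_def by (intro add_mono) auto
  also have "\<dots> \<le> 2 * m * b ^ (e + m) + 2 * b ^ (e + m)"
  proof (rule add_mono)
    show "2 * m * b ^ e \<le> 2 * m * b ^ (e + m)" by (intro mult_left_mono power_increasing) (auto simp: b_def)
  qed (simp add: add.commute)
  also have "\<dots> = 2 * Suc m * b ^ (e + m)" by simp
  finally show ?case unfolding Suc_choose_two_exponent e_def b_def .
qed simp

section \<open>Walks in the dual graph\<close>

locale disk_arrangement =
  fixes \<D> :: "complex set set"
  assumes finite_disks: "finite \<D>"
    and disk: "D \<in> \<D> \<Longrightarrow> topological_disk D"
    and general: "general_position \<D>"
begin

abbreviation boundary :: "complex set" where
  "boundary \<equiv> \<Union>D\<in>\<D>. frontier D"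

text \<open>The label is the disk whose boundary is crossed. One common limit point that is not a
  vertex is all that is asked; that the faces share an entire edge is derived from it.\<close>

definition crosses :: "complex set \<Rightarrow> complex set \<Rightarrow> complex set \<Rightarrow> bool" where
  "crosses D F G \<longleftrightarrow> D \<in> \<D> \<and> F \<in> arr_faces \<D> \<and> G \<in> arr_faces \<D> \<and>
     (F \<subseteq> interior D \<and> G \<inter> D = {} \<or> G \<subseteq> interior D \<and> F \<inter> D = {}) \<and>
     (\<exists>z \<in> frontier D - arr_vertices \<D>. z \<in> closure F \<inter> closure G)"

lemma crosses_sym: "crosses D F G \<Longrightarrow> crosses D G F"
  unfolding crosses_def by blast

lemma closed_boundary: "closed boundary"
  using finite_disks by (intro closed_UN) auto

lemma finite_arr_vertices: "finite (arr_vertices \<D>)"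
  unfolding arr_vertices_def
proof (intro finite_UN_I finite_disks finite_Diff)
  fix A B assume "A \<in> \<D>" "B \<in> \<D> - {A}"
  then show "finite (frontier A \<inter> frontier B)"
    using general unfolding general_position_def by blast
qed

lemma face_nonempty: "F \<in> arr_faces \<D> \<Longrightarrow> F \<noteq> {}"
  unfolding arr_faces_def by (rule in_components_nonempty)

lemma face_avoids_boundary: "F \<in> arr_faces \<D> \<Longrightarrow> F \<inter> boundary = {}"
  using in_components_subset[of F "- boundary"] unfolding arr_faces_def by blast

lemma connected_face: "F \<in> arr_faces \<D> \<Longrightarrow> connected F"
  unfolding arr_faces_def by (rule in_components_connected)

lemma faces_eqI: "F \<in> arr_faces \<D> \<Longrightarrow> G \<in> arr_faces \<D> \<Longrightarrow> x \<in> F \<Longrightarrow> x \<in> G \<Longrightarrow> F = G"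
  using components_nonoverlap[of F "- boundary" G] unfolding arr_faces_def by blast

lemma face_side:
  assumes "F \<in> arr_faces \<D>" "D \<in> \<D>"
  shows "F \<subseteq> interior D \<or> F \<inter> D = {}"
proof -
  have avoid: "F \<inter> frontier D = {}" using face_avoids_boundary[OF assms(1)] assms(2) by blast
  have "F \<inter> frontier (interior D) = {}"
    using avoid frontier_interior_disk[OF disk[OF assms(2)]] by simp
  then have "F \<subseteq> interior D \<or> F \<inter> interior D = {}"
    using connected_Int_frontier[OF connected_face[OF assms(1)], of "interior D"] by blast
  then show ?thesis using avoid disk_eq_interior_Un_frontier[OF disk[OF assms(2)]] by blast
qed

lemma face_subset_region:
  assumes "S \<subseteq> \<D>" "R \<in> components (\<Inter>i\<in>S. interior i)" "F \<in> arr_faces \<D>" "F \<inter> R \<noteq> {}"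
  shows "F \<subseteq> R"
proof (rule components_maximal[OF assms(2) connected_face[OF assms(3)]])
  show "F \<subseteq> (\<Inter>i\<in>S. interior i)"
  proof (rule INT_greatest)
    fix i assume i: "i \<in> S"
    then have "R \<subseteq> interior i" using in_components_subset[OF assms(2)] by blast
    then have "F \<inter> D \<noteq> {}" if "D = i" for D using assms(4) interior_subset[of i] that by blast
    then show "F \<subseteq> interior i" using face_side[OF assms(3), of i] assms(1) i by blast
  qed
qed (use assms(4) in blast)

text \<open>Near a point that is not a vertex only the boundary of \<open>D\<close> is present, and
  by uniform connectedness the part inside \<open>D\<close> and the part outside each belong to a
  single face.\<close>

lemma local_two_sided:
  assumes D: "D \<in> \<D>" and z: "z \<in> frontier D" "z \<notin> arr_vertices \<D>"
  obtains W F G where "open W" "z \<in> W" "W \<inter> boundary \<subseteq> frontier D"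
    "W \<inter> interior D \<subseteq> F" "W - D \<subseteq> G" "crosses D F G" "F \<subseteq> interior D"
    "\<And>y. y \<in> W \<inter> frontier D \<Longrightarrow> y \<in> closure F \<inter> closure G"
proof -
  define K where "K = (\<Union>C\<in>\<D> - {D}. frontier C)"
  have "closed K" unfolding K_def using finite_disks by (intro closed_UN) auto
  moreover have "z \<notin> K" using z D unfolding K_def arr_vertices_def by blast
  ultimately obtain e where e: "e > 0" "ball z e \<subseteq> - K"
    using openE[of "- K" z] by blast
  obtain d where d: "d > 0" "d \<le> e"
    "\<And>x y. x \<in> ball z d \<inter> interior D \<Longrightarrow> y \<in> ball z d \<inter> interior D \<Longrightarrow> connected_component (ball z e \<inter> interior D) x y"
    "\<And>x y. x \<in> ball z d - D \<Longrightarrow> y \<in> ball z d - D \<Longrightarrow> connected_component (ball z e - D) x y"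
    by (rule disk_uniformly_connected[OF disk[OF D] z(1) e(1)]) blast
  have BK: "boundary = K \<union> frontier D" using D unfolding K_def by blast
  have sub: "ball z d \<subseteq> ball z e" using d(2) by (rule subset_ball)
  have frD: "frontier D \<subseteq> closure (interior D)" "frontier D \<subseteq> closure (- D)"
    using frontier_interior_disk[OF disk[OF D]] unfolding frontier_closures by blast+
  have Dfr: "D = interior D \<union> frontier D" using disk_eq_interior_Un_frontier[OF disk[OF D]] .
  have free: "ball z e \<inter> interior D \<subseteq> - boundary" "ball z e - D \<subseteq> - boundary"
    using e(2) Dfr unfolding BK by (auto simp: frontier_def)
  have near: "ball z d \<inter> interior D \<noteq> {}" "ball z d \<inter> - D \<noteq> {}"
    using closure_meets_open[OF subsetD[OF frD(1) z(1)], of "ball z d"]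
      closure_meets_open[OF subsetD[OF frD(2) z(1)], of "ball z d"] d(1) by auto
  then obtain x y where x: "x \<in> ball z d \<inter> interior D" and y: "y \<in> ball z d - D" by blast
  define F G where "F = connected_component_set (- boundary) x" and "G = connected_component_set (- boundary) y"
  have FG: "F \<in> arr_faces \<D>" "G \<in> arr_faces \<D>"
    unfolding F_def G_def arr_faces_def using x y free sub by (blast intro: componentsI)+
  have WF: "ball z d \<inter> interior D \<subseteq> F"
    unfolding F_def using d(3)[OF x] connected_component_of_subset[OF _ free(1)] by blast
  have WG: "ball z d - D \<subseteq> G"
    unfolding G_def using d(4)[OF y] connected_component_of_subset[OF _ free(2)] by blast
  have FD: "F \<subseteq> interior D"
    using face_side[OF FG(1) D] x WF interior_subset[of D] by blast
  have GD: "G \<inter> D = {}"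
    using face_side[OF FG(2) D] y WG interior_subset[of D] by blast
  have cl: "w \<in> closure F \<inter> closure G" if w: "w \<in> ball z d \<inter> frontier D" for w
  proof
    show "w \<in> closure F"
    proof (rule in_closureI)
      fix N assume "open N" "w \<in> N"
      then have "(N \<inter> ball z d) \<inter> interior D \<noteq> {}"
        using w frD(1) by (intro closure_meets_open[of w]) auto
      then show "N \<inter> F \<noteq> {}" using WF by blast
    qed
    show "w \<in> closure G"
    proof (rule in_closureI)
      fix N assume "open N" "w \<in> N"
      then have "(N \<inter> ball z d) \<inter> - D \<noteq> {}"
        using w frD(2) by (intro closure_meets_open[of w]) auto
      then show "N \<inter> G \<noteq> {}" using WG by blast
    qed
  qed
  show thesis
  proof
    show "open (ball z d)" "z \<in> ball z d" using d(1) by auto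
    show "ball z d \<inter> boundary \<subseteq> frontier D" using sub e(2) unfolding BK by blast
    have "z \<in> closure F \<inter> closure G" using cl z(1) d(1) by simp
    then show "crosses D F G" unfolding crosses_def using D FG FD GD z by blast
    show "w \<in> closure F \<inter> closure G" if "w \<in> ball z d \<inter> frontier D" for w using cl[OF that] .
  qed (fact WF WG FD)+
qed

text \<open>Lying on the boundary of \<open>D\<close> and in the closures of both faces is a
  property that spreads along the edge through the contact point, because by
  \<open>local_two_sided\<close> it is locally constant there.\<close>

lemma crosses_common_edge_interior:
  assumes "crosses D F G" "F \<subseteq> interior D" "G \<inter> D = {}"
  shows "\<exists>e\<in>arr_edges \<D>. e \<subseteq> closure F \<inter> closure G"
proof -
  have D: "D \<in> \<D>" and FG: "F \<in> arr_faces \<D>" "G \<in> arr_faces \<D>" using assms(1) unfolding crosses_def by auto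
  obtain z where z: "z \<in> frontier D" "z \<notin> arr_vertices \<D>" "z \<in> closure F \<inter> closure G"
    using assms(1) unfolding crosses_def by blast
  let ?M = "boundary - arr_vertices \<D>"
  define e where "e = connected_component_set ?M z"
  have zM: "z \<in> ?M" using z D by blast
  have e: "e \<in> components ?M" unfolding e_def using zM by (rule componentsI)
  let ?P = "\<lambda>a. a \<in> frontier D \<and> a \<in> closure F \<inter> closure G"
  have "?P b" if b: "b \<in> e" for b
  proof (rule connected_induction_simple[of e z b ?P])
    show "connected e" using e by (rule in_components_connected)
    show "z \<in> e" unfolding e_def using zM by simp
    show "b \<in> e" by fact
    show "?P z" using z by blast
    fix a assume a: "a \<in> e"
    then have "a \<in> ?M" using in_components_subset[OF e] by blast
    then obtain D' where D': "D' \<in> \<D>" "a \<in> frontier D'" "a \<notin> arr_vertices \<D>" by blast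
    obtain W F' G' where W: "open W" "a \<in> W" "W \<inter> boundary \<subseteq> frontier D'"
      "W \<inter> interior D' \<subseteq> F'" "W - D' \<subseteq> G'" "crosses D' F' G'" "F' \<subseteq> interior D'"
      "\<And>y. y \<in> W \<inter> frontier D' \<Longrightarrow> y \<in> closure F' \<inter> closure G'"
      by (rule local_two_sided[OF D']) blast
    have FG': "F' \<in> arr_faces \<D>" "G' \<in> arr_faces \<D>" using W(6) unfolding crosses_def by auto
    show "\<exists>T. openin (top_of_set e) T \<and> a \<in> T \<and> (\<forall>x\<in>T. \<forall>y\<in>T. ?P x \<longrightarrow> ?P y)"
    proof (intro exI conjI ballI impI)
      show "openin (top_of_set e) (e \<inter> W)" using W(1) by (simp add: openin_open_Int)
      show "a \<in> e \<inter> W" using a W(2) by blast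
      fix x y assume x: "x \<in> e \<inter> W" and y: "y \<in> e \<inter> W" and Px: "?P x"
      have xy: "x \<in> ?M" "y \<in> ?M" using x y in_components_subset[OF e] by blast+
      then have "x \<in> frontier D'" "y \<in> frontier D'" using x y W(3) by blast+
      \<comment> \<open>The point \<open>x\<close> lies on both boundaries and is not a
        vertex.\<close>
      have "D' = D"
        using xy(1) \<open>x \<in> frontier D'\<close> Px D D'(1) unfolding arr_vertices_def by blast
      have "W \<inter> F \<noteq> {}" "W \<inter> G \<noteq> {}"
        using Px x W(1) closure_meets_open[of x F W] closure_meets_open[of x G W] by blast+
      then obtain u v where uv: "u \<in> W" "u \<in> F" "v \<in> W" "v \<in> G" by blast
      have "u \<in> F'" using uv assms(2) W(4) \<open>D' = D\<close> by blast
      then have "F = F'" using faces_eqI[OF FG(1) FG'(1)] uv by blast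
      have "v \<in> G'" using uv assms(3) W(5) \<open>D' = D\<close> by blast
      then have "G = G'" using faces_eqI[OF FG(2) FG'(2)] uv by blast
      show "y \<in> frontier D" using \<open>y \<in> frontier D'\<close> \<open>D' = D\<close> by simp
      have "y \<in> closure F' \<inter> closure G'" using W(8) y \<open>y \<in> frontier D'\<close> by blast
      then show "y \<in> closure F \<inter> closure G" using \<open>F = F'\<close> \<open>G = G'\<close> by simp
    qed
  qed
  then have "e \<subseteq> closure F \<inter> closure G" by blast
  then show ?thesis using e unfolding arr_edges_def by blast
qed

lemma crosses_imp_arc:
  assumes "crosses D F G"
  shows "(F, G) \<in> parcs (dual_graph \<D>)"
proof -
  have FG: "F \<in> arr_faces \<D>" "G \<in> arr_faces \<D>" using assms unfolding crosses_def by auto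
  have "\<exists>e\<in>arr_edges \<D>. e \<subseteq> closure F \<inter> closure G"
    using assms crosses_common_edge_interior[of D F G] crosses_common_edge_interior[of D G F] crosses_sym[of D F G]
    unfolding crosses_def by (metis Int_commute)
  then obtain e where e: "e \<in> arr_edges \<D>" "e \<subseteq> closure F \<inter> closure G" by blast
  have "e \<subseteq> boundary" using in_components_subset e(1) unfolding arr_edges_def by blast
  \<comment> \<open>Faces are disjoint from the boundary curves, so points of \<open>e\<close> in
    their closures are frontier points.\<close>
  then have "e \<subseteq> frontier F" "e \<subseteq> frontier G"
    using e(2) face_avoids_boundary[OF FG(1)] face_avoids_boundary[OF FG(2)] interior_subset[of F] interior_subset[of G]
    unfolding frontier_def by blast+
  moreover have "F \<noteq> G"
    using assms face_nonempty[OF FG(1)] interior_subset[of D] unfolding crosses_def by blast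
  ultimately show ?thesis using FG e(1) by (auto simp: dual_graph_def)
qed

section \<open>Counting crossings inside a region\<close>

text \<open>Base case of the recursion: with no counted label the budget 0 only asks for
  connectivity. The open connected region stays connected without the finitely many vertices, and
  near each remaining point there are at most two faces, which are linked by a crossing.\<close>

lemma faces_linked:
  assumes S: "S \<subseteq> \<D>" and R: "R \<in> components (\<Inter>i\<in>S. interior i)"
    and X: "X \<in> arr_faces \<D>" "X \<subseteq> R" and Y: "Y \<in> arr_faces \<D>" "Y \<subseteq> R"
  shows "lwalk crosses {} {F \<in> arr_faces \<D>. F \<subseteq> R} 0 X Y"
proof -
  let ?A = "{F \<in> arr_faces \<D>. F \<subseteq> R}"
  define face where "face a = connected_component_set (- boundary) a" for a
  have face: "face a \<in> arr_faces \<D>" "a \<in> face a" if "a \<notin> boundary" for a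
    using that unfolding face_def arr_faces_def by (auto intro: componentsI)
  have face_eq: "face a = F" if "F \<in> arr_faces \<D>" "a \<in> F" for a F
  proof -
    have "a \<notin> boundary" using that face_avoids_boundary by blast
    then show ?thesis using faces_eqI[OF face(1) that(1) face(2) that(2)] by simp
  qed
  have face_R: "face a \<in> ?A" if "a \<notin> boundary" "a \<in> R" for a
    using face_subset_region[OF S R face(1)] face that by blast
  have "finite S" using S finite_disks by (rule finite_subset)
  then have "open (\<Inter>i\<in>S. interior i)" by (intro open_INT) auto
  then have "open R" using R by (rule open_components)
  have "connected R" using R by (rule in_components_connected)
  let ?S = "R - arr_vertices \<D>"
  have "connected ?S"
    by (rule connected_open_delete_finite[OF \<open>open R\<close> \<open>connected R\<close>]) (auto simp: finite_arr_vertices)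
  have "closed (arr_vertices \<D>)" using finite_arr_vertices by (rule finite_imp_closed)
  then have openS: "open ?S" using \<open>open R\<close> by (rule open_Diff[rotated])
  have vb: "arr_vertices \<D> \<subseteq> boundary" unfolding arr_vertices_def by blast
  obtain a b where ab: "a \<in> X" "b \<in> Y" using face_nonempty X(1) Y(1) by blast
  have nb: "a \<notin> boundary" "b \<notin> boundary"
    using ab face_avoids_boundary[OF X(1)] face_avoids_boundary[OF Y(1)] by blast+
  \<comment> \<open>Only points off the boundary have a face; the predicate in the connectedness
    principle restricts the relation to these points, which are dense.\<close>
  let ?Rel = "\<lambda>x y. lwalk crosses {} ?A 0 (face x) (face y)"
  have "?Rel a b"
  proof (rule connected_equivalence_relation_gen[OF \<open>connected ?S\<close>, where P = "\<lambda>x. x \<notin> boundary" and R = ?Rel])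
    show "a \<in> ?S" "b \<in> ?S" using ab nb X(2) Y(2) vb by blast+
    show "a \<notin> boundary" "b \<notin> boundary" by fact+
    show "?Rel x z" if "?Rel x y" "?Rel y z" for x y z
      using lwalk_append[OF that] by simp
  next
    fix T c assume T: "openin (top_of_set ?S) T" "c \<in> T"
    then have "open T" using openS openin_open_eq by blast
    have cS: "c \<in> ?S" using T openin_imp_subset by blast
    show "\<exists>z. z \<in> T \<and> z \<notin> boundary"
    proof (cases "c \<in> boundary")
      case True
      then obtain D where D: "D \<in> \<D>" "c \<in> frontier D" by blast
      have "c \<notin> arr_vertices \<D>" using cS by blast
      obtain W F where W: "open W" "c \<in> W" "W \<inter> interior D \<subseteq> F" "F \<in> arr_faces \<D>"
        by (rule local_two_sided[OF D \<open>c \<notin> arr_vertices \<D>\<close>]) (auto simp: crosses_def)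
      have "c \<in> closure (interior D)"
        using D(2) frontier_interior_disk[OF disk[OF D(1)]] unfolding frontier_closures by blast
      then have "(T \<inter> W) \<inter> interior D \<noteq> {}"
        using W(1,2) T(2) \<open>open T\<close> by (intro closure_meets_open[of c]) auto
      then show ?thesis using W(3) face_avoids_boundary[OF W(4)] by blast
    qed (use T in blast)
  next
    fix c assume c: "c \<in> ?S"
    show "\<exists>T. openin (top_of_set ?S) T \<and> c \<in> T \<and>
        (\<forall>x\<in>T. \<forall>y\<in>T. x \<notin> boundary \<and> y \<notin> boundary \<longrightarrow> ?Rel x y)"
    proof (cases "c \<in> boundary")
      case True
      then obtain D where D: "D \<in> \<D>" "c \<in> frontier D" by blast
      have "c \<notin> arr_vertices \<D>" using c by blast
      obtain W F G where W: "open W" "c \<in> W" "W \<inter> interior D \<subseteq> F" "W - D \<subseteq> G" "crosses D F G"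
        by (rule local_two_sided[OF D \<open>c \<notin> arr_vertices \<D>\<close>]) blast
      have FG: "F \<in> arr_faces \<D>" "G \<in> arr_faces \<D>" using W(5) unfolding crosses_def by auto
      show ?thesis
      proof (intro exI conjI ballI impI)
        show "openin (top_of_set ?S) (?S \<inter> W)" using W(1) by (simp add: openin_open_Int)
        show "c \<in> ?S \<inter> W" using c W(2) by blast
        fix x y assume x: "x \<in> ?S \<inter> W" and y: "y \<in> ?S \<inter> W" and xy: "x \<notin> boundary \<and> y \<notin> boundary"
        have side: "face u = F \<or> face u = G" if u: "u \<in> ?S \<inter> W" "u \<notin> boundary" for u
        proof -
          have "u \<notin> frontier D" using u D(1) by blast
          then have "u \<in> interior D \<or> u \<notin> D" using disk_eq_interior_Un_frontier[OF disk[OF D(1)]] by blast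
          then have "u \<in> F \<or> u \<in> G" using u W(3,4) by blast
          then show ?thesis using face_eq FG by blast
        qed
        have fx: "face x \<in> ?A" "face y \<in> ?A" using face_R x y xy by blast+
        have "face x = face y \<or> crosses D (face x) (face y)"
          using side[of x] side[of y] x y xy W(5) crosses_sym[OF W(5)] by blast
        then show "?Rel x y"
        proof
          assume "face x = face y"
          then show ?thesis using fx by (simp add: lwalk.nil)
        next
          assume "crosses D (face x) (face y)"
          then show ?thesis by (rule lwalk.free) (use fx in \<open>auto intro: lwalk.nil\<close>)
        qed
      qed
    next
      case False
      have "open (face c)"
        unfolding face_def using closed_boundary by (intro open_connected_component open_Compl)
      show ?thesis
      proof (intro exI conjI ballI impI)
        show "openin (top_of_set ?S) (?S \<inter> face c)" using \<open>open (face c)\<close> by (simp add: openin_open_Int)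
        show "c \<in> ?S \<inter> face c" using c face(2)[OF False] by blast
        fix x y assume x: "x \<in> ?S \<inter> face c" and y: "y \<in> ?S \<inter> face c"
        have "face x = face c" "face y = face c" using face_eq[OF face(1)[OF False]] x y by blast+
        moreover have "face c \<in> ?A" using face_R[OF False] c by blast
        ultimately show "?Rel x y" by (simp add: lwalk.nil)
      qed
    qed
  qed
  then show ?thesis using face_eq[OF X(1) ab(1)] face_eq[OF Y(1) ab(2)] by simp
qed

text \<open>Induction on the counted labels, for all regions at once. For a new disk
  \<open>j\<close> the walk in \<open>R\<close> from the induction hypothesis is shortened by
  \<open>lwalk_shortcut\<close>, whose inner walks come from the same hypothesis for the components
  of \<open>R \<inter> interior j\<close>, regions of one more disk.\<close>

lemma region_walk:
  assumes overlap: "\<And>A B. A \<in> \<D> \<Longrightarrow> B \<in> \<D> \<Longrightarrow> A \<noteq> B \<Longrightarrow> card (components (A \<inter> B)) \<le> \<Delta>"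
    and "J \<subseteq> \<D>" "S \<subseteq> \<D>" "S \<inter> J = {}" "R \<in> components (\<Inter>i\<in>S. interior i)"
    and "X \<in> arr_faces \<D>" "X \<subseteq> R" "Y \<in> arr_faces \<D>" "Y \<subseteq> R"
  shows "lwalk crosses J {F \<in> arr_faces \<D>. F \<subseteq> R} (crossing_bound \<Delta> (card S) (card J)) X Y"
proof -
  have "finite J" using \<open>J \<subseteq> \<D>\<close> finite_disks by (rule finite_subset)
  then show ?thesis using assms(2-)
  proof (induction J arbitrary: S R X Y rule: finite_induct)
    case empty
    then show ?case using faces_linked by simp
  next
    case (insert j J)
    let ?A = "{F \<in> arr_faces \<D>. F \<subseteq> R}"
    let ?C = "components (R \<inter> interior j)"
    define g where "g = crossing_bound \<Delta> (Suc (card S)) (card J)"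
    have j: "j \<in> \<D>" "j \<notin> S" and S: "S \<subseteq> \<D>" and R: "R \<in> components (\<Inter>i\<in>S. interior i)"
      using insert.prems by auto
    have finS: "finite S" using S finite_disks by (rule finite_subset)
    have C: "finite ?C \<and> card ?C \<le> \<Delta> ^ card S"
    proof (rule card_components_Int_le[OF finS _ disk[OF j(1)] _ R])
      fix i assume i: "i \<in> S"
      then have iD: "i \<in> \<D>" "i \<noteq> j" using S j by auto
      then show "topological_disk i" using disk by blast
      have "\<And>p. p \<in> frontier i \<inter> frontier j \<Longrightarrow> properly_cross_at (frontier i) (frontier j) p"
        using general iD j(1) unfolding general_position_def by blast
      then show "finite (components (interior i \<inter> interior j)) \<and> card (components (interior i \<inter> interior j)) \<le> \<Delta>"
        using card_components_Int_interior[OF disk[OF iD(1)] disk[OF j(1)]] overlap[OF iD(1) j(1) iD(2)] by simp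
    qed
    define color where "color F = (if F \<subseteq> interior j then Some (SOME w. w \<in> ?C \<and> F \<subseteq> w) else None)" for F
    have color: "w \<in> ?C \<and> F \<subseteq> w" if "F \<in> ?A" "color F = Some w" for F w
    proof -
      have Fj: "F \<subseteq> R \<inter> interior j" using that by (auto simp: color_def split: if_splits)
      have w: "w = (SOME w. w \<in> ?C \<and> F \<subseteq> w)" using that by (auto simp: color_def split: if_splits)
      have F: "F \<in> arr_faces \<D>" using that by auto
      have "\<exists>w. w \<in> ?C \<and> F \<subseteq> w"
        using exists_component_superset[OF Fj _ connected_face[OF F]] Fj face_nonempty[OF F] by blast
      then show ?thesis unfolding w by (rule someI_ex)
    qed
    have "\<exists>m. m + (if color X = None then 0 else 1) \<le> crossing_bound \<Delta> (card S) (card J) + card ?C * (g + 2)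
        \<and> lwalk crosses (insert j J) ?A m X Y"
    proof (rule lwalk_shortcut)
      show "finite ?C" using C by blast
      \<comment> \<open>Every face in \<open>R\<close> is either uncoloured or coloured by a member
        of \<open>?C\<close>, so the shortcut starts with all colours allowed.\<close>
      have "{v \<in> ?A. color v \<in> insert None (Some ` ?C)} = ?A"
        using color by (auto simp: option.split_sel) (metis image_eqI option.exhaust)
      then show "lwalk crosses J {v \<in> ?A. color v \<in> insert None (Some ` ?C)}
          (crossing_bound \<Delta> (card S) (card J)) X Y"
        using insert.IH[of S R X Y] insert.prems by auto
      \<comment> \<open>A crossing of the boundary of \<open>j\<close> has one face inside
        \<open>j\<close>, and that face is coloured.\<close>
      show "\<not> crosses j F G" if "F \<in> ?A" "G \<in> ?A" "color F = None" "color G = None" for F G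
        using that by (auto simp: crosses_def color_def split: if_splits)
      fix F G w assume FG: "F \<in> ?A" "G \<in> ?A" "color F = Some w" "color G = Some w"
      then have w: "w \<in> ?C" "F \<subseteq> w" "G \<subseteq> w" using color by blast+
      let ?A' = "{F \<in> arr_faces \<D>. F \<subseteq> w}"
      have wR: "w \<subseteq> R" "w \<subseteq> interior j" using in_components_subset[OF w(1)] by auto
      \<comment> \<open>The region is now \<open>w\<close>, cut out by \<open>insert j S\<close>,
        and \<open>J\<close> has one label fewer than the family being treated.\<close>
      have "lwalk crosses J ?A' (crossing_bound \<Delta> (card (insert j S)) (card J)) F G"
      proof (rule insert.IH)
        show "w \<in> components (\<Inter>i\<in>insert j S. interior i)"
          using R w(1) by (rule component_Int_interior)
      qed (use insert.prems insert.hyps FG w in auto)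
      then have "lwalk crosses J ?A' g F G" using finS j(2) by (simp add: g_def)
      then show "lwalk crosses (insert j J) ?A g F G"
      proof (rule lwalk_insert_label)
        show "?A' \<subseteq> ?A" using wR by auto
        fix F G assume "F \<in> ?A'" "G \<in> ?A'"
        then have "F \<subseteq> interior j" "G \<subseteq> interior j" "F \<noteq> {}" "G \<noteq> {}" using wR face_nonempty by auto
        then have "F \<inter> j \<noteq> {}" "G \<inter> j \<noteq> {}" using interior_subset[of j] by blast+
        then show "\<not> crosses j F G" unfolding crosses_def by blast
      qed
    qed
    then obtain m where "m + (if color X = None then 0 else 1)
        \<le> crossing_bound \<Delta> (card S) (card J) + card ?C * (g + 2)"
      and m_walk: "lwalk crosses (insert j J) ?A m X Y" by blast
    then have m_le: "m \<le> crossing_bound \<Delta> (card S) (card J) + card ?C * (g + 2)" by linarith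
    have "card ?C * (g + 2) \<le> \<Delta> ^ card S * (g + 2)" using C by (intro mult_right_mono) auto
    then have "m \<le> crossing_bound \<Delta> (card S) (card (insert j J))"
      using m_le insert.hyps by (simp add: g_def)
    then show ?case by (rule lwalk_mono[OF m_walk])
  qed
qed

text \<open>Every crossing carries a label from \<open>\<D>\<close>, so with all of
  \<open>\<D>\<close> counted no edge is free and the budget bounds the length.\<close>

lemma lwalk_imp_awalk:
  assumes "lwalk crosses \<D> A k X Y" "Y \<in> arr_faces \<D>"
  shows "\<exists>p. pre_digraph.awalk (with_proj (dual_graph \<D>)) X p Y \<and> length p \<le> k"
proof -
  interpret wf_digraph "with_proj (dual_graph \<D>)" by (rule wf_dual_graph)
  show ?thesis using assms
  proof (induction rule: lwalk.induct)
    case (nil x k)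
    then have "x \<in> verts (with_proj (dual_graph \<D>))" by (simp add: dual_graph_def)
    then show ?case by (intro exI[of _ "[]"]) (simp add: awalk_Nil_iff)
  next
    case (free l x y k z)
    then show ?case by (simp add: crosses_def)
  next
    case (step l x y k z)
    then obtain p where p: "awalk y p z" "length p \<le> k" by blast
    have "(x, y) \<in> parcs (dual_graph \<D>)" using step(1) by (rule crosses_imp_arc)
    then have "awalk x ((x, y) # p) z" using p by (simp add: awalk_Cons_iff)
    then show ?case using p by (intro exI[of _ "(x, y) # p"]) simp
  qed
qed

end

section \<open>The diameter bound\<close>

theorem theorem3:
  fixes \<D> :: "complex set set" and n \<Delta> :: nat
  assumes "n > 2"
    and "card \<D> = n"
    and "\<And>D. D \<in> \<D> \<Longrightarrow> topological_disk D"
    and "general_position \<D>"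
    and "overlap_number \<D> = \<Delta>"
  shows "graph_diameter (with_proj (dual_graph \<D>))
           \<le> ereal (real (2 * n * min n (\<Delta> + 1) * (\<Delta> + 1) ^ (n * (n - 1) div 2)))"
proof -
  have "finite \<D>" using assms(1,2) by (intro card_ge_0_finite) simp
  then interpret disk_arrangement \<D>
    using assms(3,4) by unfold_locales
  interpret G: wf_digraph "with_proj (dual_graph \<D>)" by (rule wf_dual_graph)
  let ?k = "2 * n * min n (\<Delta> + 1) * (\<Delta> + 1) ^ (n * (n - 1) div 2)"
  have overlap: "card (components (A \<inter> B)) \<le> \<Delta>" if "A \<in> \<D>" "B \<in> \<D>" "A \<noteq> B" for A B
  proof -
    have "{card (components (A \<inter> B)) | A B. A \<in> \<D> \<and> B \<in> \<D> \<and> A \<noteq> B}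
        \<subseteq> (\<lambda>(A, B). card (components (A \<inter> B))) ` (\<D> \<times> \<D>)" by auto
    then have "finite {card (components (A \<inter> B)) | A B. A \<in> \<D> \<and> B \<in> \<D> \<and> A \<noteq> B}"
      by (rule finite_subset) (use \<open>finite \<D>\<close> in simp)
    then show ?thesis
      using that assms(5) unfolding overlap_number_def by (auto intro!: Max_ge)
  qed
  have "crossing_bound \<Delta> 0 n \<le> 2 * n * (\<Delta> + 1) ^ (n * (n - 1) div 2)" by (rule crossing_bound_zero)
  also have "\<dots> \<le> ?k"
  proof (rule mult_right_mono)
    \<comment> \<open>The minimum is at least 1, since \<open>n > 2\<close>.\<close>
    show "2 * n \<le> 2 * n * min n (\<Delta> + 1)" using assms(1) by simp
  qed simp
  finally have bound: "crossing_bound \<Delta> 0 n \<le> ?k" .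
  have "G.\<mu> (\<lambda>_. 1) X Y \<le> ereal (real ?k)"
    if XY: "X \<in> arr_faces \<D>" "Y \<in> arr_faces \<D>" for X Y
  proof -
    \<comment> \<open>The recursion starts with no disk intersected: the only region is the whole
      plane, and all \<open>n\<close> boundaries are counted.\<close>
    have "UNIV \<in> components (\<Inter>i\<in>{}. interior (i :: complex set))" by (simp add: in_components_self)
    from region_walk[OF overlap _ _ _ this XY(1) _ XY(2), of \<D>]
    have "lwalk crosses \<D> {F \<in> arr_faces \<D>. F \<subseteq> UNIV} (crossing_bound \<Delta> 0 n) X Y"
      using assms(2) by simp
    then obtain p where p: "G.awalk X p Y" "length p \<le> crossing_bound \<Delta> 0 n"
      using lwalk_imp_awalk[OF _ XY(2)] by blast
    have "G.awalk_cost (\<lambda>_. 1) p = real (length p)" by (induction p) (auto simp: G.awalk_cost_def)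
    then have "G.\<mu> (\<lambda>_. 1) X Y \<le> ereal (real (length p))"
      using G.min_cost_le_walk_cost[OF p(1), of "\<lambda>_. 1"] by simp
    also have "\<dots> \<le> ereal (real ?k)" unfolding ereal_less_eq(3) of_nat_le_iff using p(2) bound by (rule le_trans)
    finally show ?thesis .
  qed
  then show ?thesis
    unfolding graph_diameter_def by (intro SUP_least) (simp add: dual_graph_def)
qed

end
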